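(* There is a surjective algebra homomorphism $$\widetilde{\mathcal A}\otimes_{\mathbb Z[q_1^{\pm1},q_2^{\pm1}]}\mathbb Z[q^{\pm1}]\ \longrightarrow\ \bigoplus_{n\ge0}\operatorname{Tr}(\mathrm{AH}_n),$$ where $\mathbb Z[q_1^{\pm1},q_2^{\pm1}]\to\mathbb Z[q^{\pm1}]$ is $q_1\mapsto q^{-2}$, $q_2\mapsto q^2$, the target carries the skein product, and the homomorphism sends each generator $\mathscr E_{(d_1,\dots,d_n)}$ to $q^{1-n}\,[Y_1^{d_1}\cdots Y_n^{d_n}T_1\cdots T_{n-1}]\in\operatorname{Tr}(\mathrm{AH}_n)$.
   Context: Extended affine braid group $\mathrm{ABr}_n$: generators $\sigma_0,\dots,\sigma_{n-1},\omega$ (indices mod $n$), relations $\sigma_i\sigma_{i+1}\sigma_i=\sigma_{i+1}\sigma_i\sigma_{i+1}$, $\sigma_i\sigma_j=\sigma_j\sigma_i$ ($|i-j|>1$ mod $n$), $\omega\sigma_i\omega^{-1}=\sigma_{i+1}$; $y_i=\sigma_{i-1}^{-1}\cdots\sigma_1^{-1}\omega\sigma_{n-1}\cdots\sigma_i$ ($1\le i\le n$), pairwise commuting. The extended affine Hecke algebra $\mathrm{AH}_n$ is the quotient of the group algebra $\mathbb Z[q^{\pm1}][\mathrm{ABr}_n]$ by $(T_i-q)(T_i+q^{-1})=0$ for all $i\in\mathbb Z/n$, where $T_i,\Omega,Y_i$ denote the images of $\sigma_i,\omega,y_i$. Its cocenter is $\operatorname{Tr}(\mathrm{AH}_n)=\mathrm{AH}_n/[\mathrm{AH}_n,\mathrm{AH}_n]$,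 with $[x]$ the class of $x$; $\operatorname{Tr}(\mathrm{AH}_0)=\mathbb Z[q^{\pm1}]$. The skein product $\operatorname{Tr}(\mathrm{AH}_n)\otimes\operatorname{Tr}(\mathrm{AH}_k)\to\operatorname{Tr}(\mathrm{AH}_{n+k})$ is induced by the group homomorphism $\mathrm{ABr}_n\times\mathrm{ABr}_k\to\mathrm{ABr}_{n+k}$ sending $\sigma_i,y_i$ of the first factor to $\sigma_i,y_i$ and $\sigma_j,y_j$ of the second factor to $\sigma_{j+n},y_{j+n}$. The algebra $\widetilde{\mathcal A}$ is the $\mathbb Z[q_1^{\pm1},q_2^{\pm1}]$-algebra generated by symbols $\mathscr E_{(d_1,\dots,d_n)}$ ($n\ge1$, $d_i\in\mathbb Z$) subject to: for all $d_1,\dots,d_n$ and $1\le i\le n-1$, $\mathscr E_{(d_1,\dots,d_i,d_{i+1},\dots,d_n)}-q_1q_2\,\mathscr E_{(d_1,\dots,d_i-1,d_{i+1}+1,\dots,d_n)}=(1-q_1)\,\mathscr E_{(d_1,\dots,d_i)}\mathscr E_{(d_{i+1},\dots,d_n)}$; and for all $d_1,\dots,d_n,k\in\mathbb Z$, $[\mathscr E_{(k)},\mathscr E_{(d_1,\dots,d_n)}]=(q_2-1)\sum_{i=1}^n c_i$, where $c_i=\sum_{a=1}^{k-d_i}\mathscr E_{(d_1,\dots,d_{i-1},k-a,d_i+a,d_{i+1},\dots,d_n)}$ if $k\ge d_i$ and $c_i=-\sum_{a=1}^{d_i-k}\mathscr E_{(d_1,\dots,d_{i-1},d_i-a,k+a,d_{i+1},\dots,d_n)}$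 if $k\le d_i$.
   Formalization: For n=1 the group ABr_1 is generated by ω alone (no σ_0), and for n=2 no braid relation between σ_0 and σ_1 is imposed; with the literal presentation T_0 in Tr(AH_1) is not hit and the skein product is not well defined. *)

theory Defs
  imports "HOL-Library.Poly_Mapping"
begin

type_synonym laur = "int \<Rightarrow>\<^sub>0 int"

text \<open>q^k as a Laurent monomial (the multiplication on int =>0 int is convolution).\<close>
definition qp :: "int \<Rightarrow> laur" where
  "qp k = Poly_Mapping.single k 1"

type_synonym 'b fm = "'b \<Rightarrow>\<^sub>0 laur"

definition smul :: "laur \<Rightarrow> 'b fm \<Rightarrow> 'b fm" where
  "smul c p = (\<Sum>b\<in>Poly_Mapping.keys p. Poly_Mapping.single b (c * Poly_Mapping.lookup p b))"

definition conv :: "('b \<Rightarrow> 'b \<Rightarrow> 'b) \<Rightarrow> 'b fm \<Rightarrow> 'b fm \<Rightarrow> 'b fm" where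
  "conv f p r = (\<Sum>a\<in>Poly_Mapping.keys p. \<Sum>b\<in>Poly_Mapping.keys r. Poly_Mapping.single (f a b) (Poly_Mapping.lookup p a * Poly_Mapping.lookup r b))"

definition lin :: "(laur \<times> 'b) list \<Rightarrow> 'b fm" where
  "lin xs = (\<Sum>(c, b)\<leftarrow>xs. Poly_Mapping.single b c)"

definition lspan :: "'b fm set \<Rightarrow> 'b fm set" where
  "lspan S = {x. \<exists>xs. set (map snd xs) \<subseteq> S \<and> x = (\<Sum>(c, v)\<leftarrow>xs. smul c v)}"

text \<open>Letters: S i = sigma_i, Si i = sigma_i^-1 (i in Z/n, represented by 0..n-1),
  W = omega, Wi = omega^-1.\<close>
datatype lett = S nat | Si nat | W | Wi

definition valid_lett :: "nat \<Rightarrow> lett \<Rightarrow> bool" where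
  "valid_lett n l = (case l of
      S i \<Rightarrow> 2 \<le> n \<and> i < n
    | Si i \<Rightarrow> 2 \<le> n \<and> i < n
    | W \<Rightarrow> 1 \<le> n
    | Wi \<Rightarrow> 1 \<le> n)"

definition valid_word :: "nat \<Rightarrow> lett list \<Rightarrow> bool" where
  "valid_word n w = (\<forall>l\<in>set w. valid_lett n l)"

text \<open>Defining relations of AH_n (as elements "sum c * word = 0"): inverses,
  the group relations of ABr_n, and the Hecke relation (T_i - q)(T_i + q^-1) = 0.\<close>
definition ah_rels :: "nat \<Rightarrow> (laur \<times> lett list) list set" where
  "ah_rels n =
     (if 1 \<le> n then {[(1, [W, Wi]), (-1, [])], [(1, [Wi, W]), (-1, [])]} else {})
   \<union> (if 2 \<le> n then (\<Union>i\<in>{..<n}.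
         {[(1, [S i, Si i]), (-1, [])], [(1, [Si i, S i]), (-1, [])],
          [(1, [W, S i, Wi]), (-1, [S ((i + 1) mod n)])],
          [(1, [S i, S i]), (qp (-1) - qp 1, [S i]), (-1, [])]}) else {})
   \<union> (if 3 \<le> n then
         (\<Union>i\<in>{..<n}. {[(1, [S i, S ((i + 1) mod n), S i]),
                          (-1, [S ((i + 1) mod n), S i, S ((i + 1) mod n)])]})
       \<union> {[(1, [S i, S j]), (-1, [S j, S i])] | i j.
             i < n \<and> j < n \<and> (i + n - j) mod n \<notin> {0, 1, n - 1}}
       else {})"

text \<open>Target: direct sum over n of the free Z[q^{+-1}]-modules on words for ABr_n;
  basis element (n, w).\<close>
definition Tgt :: "(nat \<times> lett list) fm set" where
  "Tgt = {x. \<forall>(n, w)\<in>Poly_Mapping.keys x. valid_word n w}"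

definition at :: "nat \<Rightarrow> lett list \<Rightarrow> lett list \<Rightarrow> (laur \<times> lett list) list
                    \<Rightarrow> (nat \<times> lett list) fm" where
  "at n a b r = lin (map (\<lambda>(c, w). (c, (n, a @ w @ b))) r)"

text \<open>Kernel of the projection onto the direct sum of the cocenters Tr(AH_n):
  the two-sided ideals I_n plus the commutator spaces.\<close>
definition Ktr :: "(nat \<times> lett list) fm set" where
  "Ktr = lspan ({at n a b r | n a b r. valid_word n a \<and> valid_word n b \<and> r \<in> ah_rels n}
              \<union> {lin [(1, (n, a @ b)), (-1, (n, b @ a))] | n a b.
                   valid_word n a \<and> valid_word n b})"

text \<open>Images of the letters of the first factor ABr_n in ABr_(n+k).\<close>
definition phi1 :: "nat \<Rightarrow> nat \<Rightarrow> lett \<Rightarrow> lett list" where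
  "phi1 n k l = (if k = 0 then [l] else
     (let N = n + k; Wm = W # map S (rev [n..<N]); Wim = map Si [n..<N] @ [Wi] in
      case l of
        W \<Rightarrow> Wm
      | Wi \<Rightarrow> Wim
      | S i \<Rightarrow> (if i = 0 then Wm @ [S (n - 1)] @ Wim else [S i])
      | Si i \<Rightarrow> (if i = 0 then Wm @ [Si (n - 1)] @ Wim else [Si i])))"

text \<open>Images of the letters of the second factor ABr_k in ABr_(n+k).\<close>
definition phi2 :: "nat \<Rightarrow> nat \<Rightarrow> lett \<Rightarrow> lett list" where
  "phi2 n k l = (if n = 0 then [l] else
     (let N = n + k; Wm = map Si (rev [1..<n + 1]) @ [W]; Wim = Wi # map S [1..<n + 1] in
      case l of
        W \<Rightarrow> Wm
      | Wi \<Rightarrow> Wim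
      | S j \<Rightarrow> (if j = 0 then Wm @ [S (N - 1)] @ Wim else [S (j + n)])
      | Si j \<Rightarrow> (if j = 0 then Wm @ [Si (N - 1)] @ Wim else [Si (j + n)])))"

definition sk :: "nat \<times> lett list \<Rightarrow> nat \<times> lett list \<Rightarrow> nat \<times> lett list" where
  "sk x y = (case x of (n, w) \<Rightarrow> case y of (k, v) \<Rightarrow>
     (n + k, concat (map (phi1 n k) w) @ concat (map (phi2 n k) v)))"

definition skein :: "(nat \<times> lett list) fm \<Rightarrow> (nat \<times> lett list) fm \<Rightarrow> (nat \<times> lett list) fm" where
  "skein = conv sk"

definition Yw :: "nat \<Rightarrow> nat \<Rightarrow> lett list" where
  "Yw n i = map Si (rev [1..<i]) @ [W] @ map S (rev [i..<n])"

definition Yiw :: "nat \<Rightarrow> nat \<Rightarrow> lett list" where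
  "Yiw n i = map Si [i..<n] @ [Wi] @ map S [1..<i]"

definition Ypow :: "nat \<Rightarrow> nat \<Rightarrow> int \<Rightarrow> lett list" where
  "Ypow n i d = (if 0 \<le> d then concat (replicate (nat d) (Yw n i))
                 else concat (replicate (nat (- d)) (Yiw n i)))"

definition Ew :: "int list \<Rightarrow> lett list" where
  "Ew ds = (let n = length ds in
     concat (map (\<lambda>i. Ypow n (i + 1) (ds ! i)) [0..<n]) @ map S [1..<n])"

definition gimg :: "int list \<Rightarrow> (nat \<times> lett list) fm" where
  "gimg ds = Poly_Mapping.single (length ds, Ew ds) (qp (1 - int (length ds)))"

section \<open>The algebra tilde-A, base-changed along q1 -> q^-2, q2 -> q^2\<close>

text \<open>Free Z[q^{+-1}]-algebra on the symbols E_d: basis = words (lists) of generators d.\<close>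
definition FreeA :: "int list list fm set" where
  "FreeA = {p. \<forall>u\<in>Poly_Mapping.keys p. \<forall>ds\<in>set u. ds \<noteq> []}"

definition q1 :: laur where "q1 = qp (-2)"
definition q2 :: laur where "q2 = qp 2"

definition relsA1 :: "int list list fm set" where
  "relsA1 = {lin [(1, [d]),
                 (- (q1 * q2), [d[i - 1 := d ! (i - 1) - 1, i := d ! i + 1]]),
                 (- (1 - q1), [take i d, drop i d])] | d i. 1 \<le> i \<and> i < length d}"

definition cterm :: "int \<Rightarrow> int list \<Rightarrow> nat \<Rightarrow> int list list fm" where
  "cterm k d i = (if d ! i \<le> k
     then lin (map (\<lambda>a. (1, [take i d @ [k - a, d ! i + a] @ drop (i + 1) d])) [1..k - d ! i])
     else lin (map (\<lambda>a. (-1, [take i d @ [d ! i - a, k + a] @ drop (i + 1) d])) [1..d ! i - k]))"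

definition relsA2 :: "int list list fm set" where
  "relsA2 = {lin [(1, [[k], d]), (-1, [d, [k]])] - smul (q2 - 1) (\<Sum>i<length d. cterm k d i)
             | d k. d \<noteq> []}"

definition IdealA :: "int list list fm set" where
  "IdealA = lspan {conv (@) (conv (@) (Poly_Mapping.single x 1) r) (Poly_Mapping.single y 1)
                    | x y r. (\<forall>ds\<in>set x. ds \<noteq> []) \<and> (\<forall>ds\<in>set y. ds \<noteq> [])
                           \<and> r \<in> relsA1 \<union> relsA2}"

text \<open>The algebra homomorphism from the free algebra, on representatives:
  E_d1 ... E_dm |-> gimg d1 * ... * gimg dm (skein product), unit |-> 1 in Tr(AH_0).\<close>
definition PsiW :: "int list list \<Rightarrow> (nat \<times> lett list) fm" where
  "PsiW u = foldr (\<lambda>ds acc. skein (gimg ds) acc) u (Poly_Mapping.single (0, []) 1)"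

definition Psi :: "int list list fm \<Rightarrow> (nat \<times> lett list) fm" where
  "Psi p = (\<Sum>u\<in>Poly_Mapping.keys p. smul (Poly_Mapping.lookup p u) (PsiW u))"

end

theory Submission
  imports Defs
begin

text \<open>
  The product of the images of generators \<open>E_d1, E_d2, \<dots>\<close> is, literally as a word, the class of
  \<open>Y^D T_J\<close>, where \<open>D\<close> is the concatenation of the \<open>d_i\<close> and \<open>T_J\<close> is the product of all \<open>T_j\<close> for
  which strands \<open>j\<close> and \<open>j + 1\<close> lie in the same block. Hence the relations of the source can be
  checked inside a single algebra \<open>AH_N\<close>, with all other blocks carried along as spectators.

  With \<open>h = q - 1/q\<close>, the first relation is \<open>T_p - T_p^-1 = h\<close> together with
  \<open>Y_(p+1) T_p = T_p^-1 Y_p\<close>. For the second, the exchange formula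
  \<open>Y_p^k Y_(p+1)^d T_p^-1 = T_p^-1 Y_p^d Y_(p+1)^k + h \<Sum> Y_p^(k-a) Y_(p+1)^(d+a)\<close> and cyclicity move the
  exponent \<open>k\<close> through the block one strand at a time; with \<open>C = T_1 \<dots> T_n\<close>, the identity
  \<open>C T_j^-1 = T_(j+1)^-1 C\<close> restores the shape of the word after each step.

  Surjectivity: \<open>AH_n\<close> is spanned by \<open>Y^D x\<close> with \<open>x\<close> in the finite Hecke algebra \<open>H_n\<close>, and
  \<open>H_(m+1) = H_m + H_m T_m H_m\<close>. If \<open>b \<in> H_m\<close> and all indices in \<open>J\<close> exceed \<open>m\<close>, then
  \<open>[Y^D a T_m b T_J] = [b Y^D a T_m T_J]\<close>, and \<open>b Y^D a\<close> is again a combination of elements \<open>Y^D' a'\<close>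
  with \<open>a' \<in> H_m\<close>; descending in \<open>m\<close> leaves only the classes \<open>[Y^D T_J]\<close>.
\<close>

section \<open>The Hecke algebra and its lattice elements\<close>

lemma commute_inverse:
  fixes x :: "'a::monoid_mult"
  assumes "x * a = b * x" "a * a' = 1" "b' * b = 1"
  shows "x * a' = b' * x"
proof -
  have "x * a' = b' * b * x * a'" using assms(3) by simp
  also have "\<dots> = b' * (x * a) * a'" by (simp add: assms(1) mult.assoc)
  also have "\<dots> = b' * x" using assms(2) by (simp add: mult.assoc)
  finally show ?thesis .
qed

lemma commute_inverse_left:
  fixes x :: "'a::monoid_mult"
  assumes "x * a = b * x" "x * x' = 1" "x' * x = 1"
  shows "x' * b = a * x'"
proof -
  have "x' * b = x' * (b * x) * x'" using assms(2) by (simp add: mult.assoc)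
  also have "\<dots> = x' * x * a * x'" by (simp add: assms(1)[symmetric] mult.assoc)
  finally show ?thesis using assms(3) by simp
qed

lemma commute_mult:
  fixes x :: "'a::monoid_mult"
  assumes "x * a = b * x" "x * c = d * x"
  shows "x * (a * c) = b * d * x"
  using assms by (metis mult.assoc)

lemma commute_prod_list:
  fixes x :: "'a::monoid_mult"
  assumes "\<And>l. l \<in> set ls \<Longrightarrow> x * f l = g l * x"
  shows "x * prod_list (map f ls) = prod_list (map g ls) * x"
  using assms
proof (induction ls)
  case (Cons a ls)
  then show ?case by (simp add: commute_mult)
qed simp

lemma prod_list_inverse:
  fixes f g :: "'b \<Rightarrow> 'a::monoid_mult"
  assumes "\<And>l. l \<in> set ls \<Longrightarrow> f l * g l = 1"
  shows "prod_list (map f ls) * prod_list (map g (rev ls)) = 1"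
  using assms
proof (induction ls)
  case (Cons l ls)
  have "prod_list (map f (l # ls)) * prod_list (map g (rev (l # ls)))
      = f l * (prod_list (map f ls) * prod_list (map g (rev ls))) * g l"
    by (simp add: mult.assoc)
  then show ?case using Cons by simp
qed simp

lemma commute_power:
  fixes x :: "'a::monoid_mult"
  assumes "x * a = b * x"
  shows "x * a ^ k = b ^ k * x"
proof (induction k)
  case (Suc k)
  then show ?case using commute_mult[OF assms] by simp
qed simp

text \<open>The relations of the affine Hecke algebra in an arbitrary ring with unit, with a central
  \<open>h\<close> in the place of q - 1/q. Index 0 belongs to the affine generator; the indices 1
  to \<open>n - 1\<close> generate the finite part.\<close>

locale affine_hecke =
  fixes n :: nat and T Ti :: "nat \<Rightarrow> 'a::{ring,monoid_mult}" and Om Omi h :: 'a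
  assumes n_pos: "1 \<le> n"
    and Om_Omi: "Om * Omi = 1" and Omi_Om: "Omi * Om = 1"
    and T_Ti: "2 \<le> n \<Longrightarrow> i < n \<Longrightarrow> T i * Ti i = 1"
    and Ti_T: "2 \<le> n \<Longrightarrow> i < n \<Longrightarrow> Ti i * T i = 1"
    and Om_T_Omi: "2 \<le> n \<Longrightarrow> i < n \<Longrightarrow> Om * T i * Omi = T ((i + 1) mod n)"
    and T_square: "2 \<le> n \<Longrightarrow> i < n \<Longrightarrow> T i * T i = 1 + h * T i"
    and braid: "3 \<le> n \<Longrightarrow> i < n \<Longrightarrow>
      T i * T ((i + 1) mod n) * T i = T ((i + 1) mod n) * T i * T ((i + 1) mod n)"
    and far: "3 \<le> n \<Longrightarrow> i < n \<Longrightarrow> j < n \<Longrightarrow> (i + n - j) mod n \<notin> {0, 1, n - 1} \<Longrightarrow> T i * T j = T j * T i"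
    and h_central: "x * h = h * x"
begin

lemma Om_T: "2 \<le> n \<Longrightarrow> i < n \<Longrightarrow> Om * T i = T ((i + 1) mod n) * Om"
  using Om_T_Omi[of i] Omi_Om by (metis mult.assoc mult.right_neutral)

lemma Om_T_Suc: "i + 1 < n \<Longrightarrow> Om * T i = T (i + 1) * Om"
  using Om_T[of i] by simp

lemma Om_T_last: "2 \<le> n \<Longrightarrow> Om * T (n - 1) = T 0 * Om"
  using Om_T[of "n - 1"] by simp

lemma T_braid: "i + 1 < n \<Longrightarrow> 1 \<le> i \<Longrightarrow> T i * T (i + 1) * T i = T (i + 1) * T i * T (i + 1)"
  using braid[of i] by simp

lemma T_far_less: "1 \<le> i \<Longrightarrow> i + 1 < j \<Longrightarrow> j < n \<Longrightarrow> T i * T j = T j * T i"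
proof -
  assume a: "1 \<le> i" "i + 1 < j" "j < n"
  have "(i + n - j) mod n = i + n - j" using a by simp
  then show ?thesis using a by (intro far) auto
qed

lemma T_far: "1 \<le> i \<Longrightarrow> i < n \<Longrightarrow> 1 \<le> j \<Longrightarrow> j < n \<Longrightarrow> i + 1 < j \<or> j + 1 < i \<Longrightarrow> T i * T j = T j * T i"
  using T_far_less[of i j] T_far_less[of j i] by auto

lemma Ti_eq: "1 \<le> i \<Longrightarrow> i < n \<Longrightarrow> Ti i = T i - h"
proof -
  assume a: "1 \<le> i" "i < n"
  have "Ti i * (T i * T i) = Ti i + h * (Ti i * T i)"
    using T_square[of i] a h_central by (simp add: distrib_left mult.assoc[symmetric])
  then have "T i = Ti i + h" using Ti_T[of i] a by (simp add: mult.assoc[symmetric])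
  then show ?thesis by simp
qed

section \<open>Ascending and descending products of the \<open>T i\<close>\<close>

definition Tup :: "nat \<Rightarrow> nat \<Rightarrow> 'a" where "Tup i j = prod_list (map T [i..<j])"
definition Tdn :: "nat \<Rightarrow> nat \<Rightarrow> 'a" where "Tdn i j = prod_list (map T (rev [i..<j]))"
definition Tidn :: "nat \<Rightarrow> nat \<Rightarrow> 'a" where "Tidn i j = prod_list (map Ti (rev [i..<j]))"
definition Tiup :: "nat \<Rightarrow> nat \<Rightarrow> 'a" where "Tiup i j = prod_list (map Ti [i..<j])"

lemma Tup_empty [simp]: "j \<le> i \<Longrightarrow> Tup i j = 1" by (simp add: Tup_def)

lemma Tup_split: "i \<le> k \<Longrightarrow> k \<le> j \<Longrightarrow> Tup i j = Tup i k * Tup k j"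
  unfolding Tup_def by (metis le_add_diff_inverse map_append prod_list.append upt_add_eq_append)

lemma Tdn_split: "i \<le> k \<Longrightarrow> k \<le> j \<Longrightarrow> Tdn i j = Tdn k j * Tdn i k"
  unfolding Tdn_def by (metis le_add_diff_inverse map_append prod_list.append rev_append upt_add_eq_append)

lemma Tup_Suc: "i < j \<Longrightarrow> Tup i j = T i * Tup (i + 1) j"
  by (simp add: Tup_def upt_conv_Cons)

lemma Tup_snoc: "i \<le> j \<Longrightarrow> Tup i (j + 1) = Tup i j * T j"
  by (simp add: Tup_def)

lemma Tdn_Suc: "i \<le> j \<Longrightarrow> Tdn i (j + 1) = T j * Tdn i j"
  by (simp add: Tdn_def)

lemma Tdn_last: "i < j \<Longrightarrow> Tdn i j = Tdn (i + 1) j * T i"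
  by (simp add: Tdn_def upt_conv_Cons)

lemma Tidn_Suc: "i \<le> j \<Longrightarrow> Tidn i (j + 1) = Ti j * Tidn i j"
  by (simp add: Tidn_def)

lemma T_Tup_far: "1 \<le> i \<Longrightarrow> 1 \<le> l \<Longrightarrow> l < n \<Longrightarrow> j \<le> n \<Longrightarrow> l + 1 < i \<or> j < l \<Longrightarrow> T l * Tup i j = Tup i j * T l"
  unfolding Tup_def by (rule commute_prod_list) (auto intro!: T_far)

lemma T_Tdn_far: "1 \<le> i \<Longrightarrow> 1 \<le> l \<Longrightarrow> l < n \<Longrightarrow> j \<le> n \<Longrightarrow> l + 1 < i \<or> j < l \<Longrightarrow> T l * Tdn i j = Tdn i j * T l"
  unfolding Tdn_def by (rule commute_prod_list) (auto intro!: T_far)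

text \<open>\<open>T l\<close> passes the factors above \<open>l + 1\<close>, the braid relation
  turns it into \<open>T (l + 1)\<close>, and this commutes with the factors below
  \<open>l\<close>.\<close>

lemma Tup_shift:
  assumes "1 \<le> i" "i \<le> l" "l + 1 < j" "j \<le> n"
  shows "Tup i j * T l = T (l + 1) * Tup i j"
proof -
  have s: "Tup i j = Tup i l * (T l * T (l + 1)) * Tup (l + 2) j"
    using assms Tup_split[of i l j] Tup_Suc[of l j] Tup_Suc[of "l+1" j]
    by (simp add: mult.assoc numeral_2_eq_2)
  have "Tup i j * T l = Tup i l * (T l * T (l + 1)) * (Tup (l + 2) j * T l)"
    by (simp add: s mult.assoc)
  also have "\<dots> = Tup i l * (T l * T (l + 1)) * (T l * Tup (l + 2) j)"
    using assms by (simp add: T_Tup_far)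
  also have "\<dots> = Tup i l * (T l * T (l + 1) * T l) * Tup (l + 2) j"
    by (simp add: mult.assoc)
  also have "\<dots> = Tup i l * T (l + 1) * (T l * T (l + 1)) * Tup (l + 2) j"
    using assms T_braid[of l] by (simp add: mult.assoc)
  also have "\<dots> = T (l + 1) * Tup i l * (T l * T (l + 1)) * Tup (l + 2) j"
    using assms T_Tup_far[of i "l+1" l] by simp
  finally show ?thesis by (simp add: s mult.assoc)
qed

text \<open>Mirror image of \<open>Tup_shift\<close>: a descending product lowers the index that
  passes through it.\<close>

lemma Tdn_shift:
  assumes "1 \<le> i" "i < l" "l < j" "j \<le> n"
  shows "Tdn i j * T l = T (l - 1) * Tdn i j"
proof -
  obtain k where k: "l = k + 1" using assms by (cases l) auto
  have s: "Tdn i j = Tdn (k + 2) j * (T (k + 1) * T k) * Tdn i k"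
    using assms k Tdn_split[of i k j] Tdn_last[of k j] Tdn_last[of "k+1" j]
    by (simp add: mult.assoc numeral_2_eq_2)
  have "Tdn i j * T l = Tdn (k + 2) j * (T (k + 1) * T k) * (Tdn i k * T (k + 1))"
    by (simp add: s k mult.assoc)
  also have "\<dots> = Tdn (k + 2) j * (T (k + 1) * T k) * (T (k + 1) * Tdn i k)"
    using assms k T_Tdn_far[of i "k+1" k] by simp
  also have "\<dots> = Tdn (k + 2) j * (T (k + 1) * T k * T (k + 1)) * Tdn i k"
    by (simp add: mult.assoc)
  also have "\<dots> = Tdn (k + 2) j * T k * (T (k + 1) * T k) * Tdn i k"
    using assms k T_braid[of k] by (simp add: mult.assoc)
  also have "\<dots> = T k * Tdn (k + 2) j * (T (k + 1) * T k) * Tdn i k"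
    using assms k T_Tdn_far[of "k+2" k j] by simp
  finally show ?thesis by (simp add: s k mult.assoc)
qed

lemma Tidn_Tup:
  assumes "1 \<le> i" "j \<le> n" shows "Tidn i j * Tup i j = 1" "Tup i j * Tidn i j = 1"
  using prod_list_inverse[of "rev [i..<j]" Ti T] prod_list_inverse[of "[i..<j]" T Ti]
    T_Ti Ti_T assms by (auto simp: Tidn_def Tup_def)

lemma Tdn_Tiup:
  assumes "1 \<le> i" "j \<le> n" shows "Tdn i j * Tiup i j = 1" "Tiup i j * Tdn i j = 1"
  using prod_list_inverse[of "rev [i..<j]" T Ti] prod_list_inverse[of "[i..<j]" Ti T]
    T_Ti Ti_T assms by (auto simp: Tdn_def Tiup_def)

section \<open>The lattice elements and their relations with the \<open>T i\<close>\<close>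

definition Y :: "nat \<Rightarrow> 'a" where "Y i = Tidn 1 i * Om * Tdn i n"
definition Yi :: "nat \<Rightarrow> 'a" where "Yi i = Tiup i n * Omi * Tup 1 i"

lemma Y_Yi: assumes "1 \<le> i" "i \<le> n" shows "Y i * Yi i = 1" "Yi i * Y i = 1"
proof -
  have "Y i * Yi i = Tidn 1 i * (Om * (Tdn i n * Tiup i n) * Omi) * Tup 1 i"
    by (simp add: Y_def Yi_def mult.assoc)
  then show "Y i * Yi i = 1" using assms by (simp add: Tdn_Tiup Om_Omi Tidn_Tup)
  have "Yi i * Y i = Tiup i n * (Omi * (Tup 1 i * Tidn 1 i) * Om) * Tdn i n"
    by (simp add: Y_def Yi_def mult.assoc)
  then show "Yi i * Y i = 1" using assms by (simp add: Tdn_Tiup Omi_Om Tidn_Tup)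
qed

text \<open>Passing from \<open>Y i\<close> to \<open>Y (i + 1)\<close> adds a leading
  \<open>Ti i\<close> and removes the trailing \<open>T i\<close>.\<close>

lemma Y_Suc: assumes "1 \<le> i" "i < n" shows "T i * Y (i + 1) * T i = Y i"
proof -
  have "T i * Y (i + 1) * T i = (T i * Ti i) * Tidn 1 i * Om * (Tdn (i + 1) n * T i)"
    using assms Tidn_Suc[of 1 i] by (simp add: Y_def mult.assoc)
  then show ?thesis using assms T_Ti[of i] Tdn_last[of i n] by (simp add: Y_def)
qed

lemma Om_Tdn: "1 \<le> i \<Longrightarrow> i \<le> j \<Longrightarrow> j < n \<Longrightarrow> Om * Tdn i j = Tdn (i + 1) (j + 1) * Om"
proof -
  assume a: "1 \<le> i" "i \<le> j" "j < n"
  have "Om * Tdn i j = prod_list (map (\<lambda>l. T (l + 1)) (rev [i..<j])) * Om"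
    unfolding Tdn_def by (rule commute_prod_list) (use a Om_T_Suc in auto)
  also have "map (\<lambda>l. T (l + 1)) (rev [i..<j]) = map T (rev [i + 1..<j + 1])"
    by (simp add: rev_map[symmetric] map_Suc_upt[symmetric] del: upt_Suc)
  finally show ?thesis by (simp add: Tdn_def)
qed

text \<open>Follow the index through the three factors of \<open>Y i\<close> from right to left. If
  \<open>i < l\<close>, the descending product lowers \<open>l\<close> by one, \<open>Om\<close>
  raises it again and the inverses commute with it. If \<open>l + 1 < i\<close>, the descending
  product commutes with it, \<open>Om\<close> raises it and the inverses lower it again.\<close>

lemma T_Y: assumes "1 \<le> i" "i \<le> n" "1 \<le> l" "l < n" "l \<noteq> i" "l + 1 \<noteq> i"
  shows "T l * Y i = Y i * T l"
proof (cases "i < l")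
  case True
  have "Y i * T l = Tidn 1 i * Om * (Tdn i n * T l)" by (simp add: Y_def mult.assoc)
  also have "\<dots> = Tidn 1 i * (Om * T (l - 1)) * Tdn i n"
    using True assms by (simp add: Tdn_shift mult.assoc)
  also have "\<dots> = Tidn 1 i * T l * Om * Tdn i n"
    using True assms Om_T_Suc[of "l - 1"] by (simp add: mult.assoc)
  also have "Tidn 1 i * T l = T l * Tidn 1 i"
    by (rule commute_inverse_left[OF T_Tup_far[symmetric] Tidn_Tup(2) Tidn_Tup(1)])
      (use assms True in auto)
  finally show ?thesis by (simp add: Y_def mult.assoc)
next
  case False
  then have l: "l + 1 < i" using assms by auto
  have "Y i * T l = Tidn 1 i * Om * (Tdn i n * T l)" by (simp add: Y_def mult.assoc)
  also have "\<dots> = Tidn 1 i * (Om * T l) * Tdn i n"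
    using l assms T_Tdn_far[of i l n] by (simp add: mult.assoc)
  also have "\<dots> = Tidn 1 i * T (l + 1) * Om * Tdn i n"
    using l assms Om_T_Suc[of l] by (simp add: mult.assoc)
  also have "Tidn 1 i * T (l + 1) = T l * Tidn 1 i"
    by (rule commute_inverse_left[OF Tup_shift Tidn_Tup(2) Tidn_Tup(1)])
      (use assms l in auto)
  finally show ?thesis by (simp add: Y_def mult.assoc)
qed

end

text \<open>The signed sum \<open>c_i\<close> of the commutator relation, with \<open>k\<close> against \<open>d = d_i\<close>.\<close>
definition exchange_sum :: "(int \<Rightarrow> int \<Rightarrow> 'a::ab_group_add) \<Rightarrow> int \<Rightarrow> int \<Rightarrow> 'a" where
  "exchange_sum f k d = (if d \<le> k then \<Sum>a=1..k - d. f (k - a) (d + a) else - (\<Sum>a=1..d - k. f (d - a) (k + a)))"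

lemma exchange_sum_same [simp]: "exchange_sum f d d = 0"
  by (simp add: exchange_sum_def)

lemma sum_int_last: "1 \<le> m \<Longrightarrow> sum g {1..m::int} = sum g {1..m - 1} + (g m :: 'a::ab_group_add)"
proof -
  assume "1 \<le> m"
  then have "{1..m} = insert m {1..m - 1}" by auto
  then show ?thesis by simp
qed

lemma sum_int_first: "1 \<le> m \<Longrightarrow> sum g {1..m::int} = g 1 + (\<Sum>a=1..m - 1. (g (a + 1) :: 'a::ab_group_add))"
proof -
  assume m: "1 \<le> m"
  then have "{1..m} = insert 1 {2..m}" by auto
  moreover have "sum g {2..m} = (\<Sum>a=1..m - 1. g (a + 1))"
    by (rule sum.reindex_bij_witness[of _ "\<lambda>a. a + 1" "\<lambda>a. a - 1"]) auto
  ultimately show ?thesis by simp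
qed

text \<open>The signs are arranged so that one recursion covers all integers \<open>k\<close>: for
  \<open>k < d\<close> the added term cancels the summand \<open>a = 1\<close> of the shifted
  negative sum.\<close>

lemma exchange_sum_Suc: "exchange_sum f (k + 1) d = exchange_sum (\<lambda>i j. f (i + 1) j) k d + f d (k + 1)"
proof (cases "d \<le> k")
  case True
  then show ?thesis
    using sum_int_last[of "k + 1 - d" "\<lambda>a. f (k + 1 - a) (d + a)"]
    by (simp add: exchange_sum_def algebra_simps)
next
  case False
  then have "(\<Sum>a=1..d - k. f (d - a + 1) (k + a)) = f d (k + 1) + (\<Sum>a=1..d - (k + 1). f (d - a) (k + 1 + a))"
    using sum_int_first[of "d - k" "\<lambda>a. f (d - a + 1) (k + a)"]
    by (simp add: algebra_simps)
  moreover have "exchange_sum f (k + 1) d = - (\<Sum>a=1..d - (k + 1). f (d - a) (k + 1 + a))"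
    using False by (auto simp: exchange_sum_def)
  ultimately show ?thesis using False by (simp add: exchange_sum_def algebra_simps)
qed

lemma exchange_sum_additive:
  assumes "\<And>x y. g (x + y) = g x + g y"
  shows "g (exchange_sum f k d) = exchange_sum (\<lambda>i j. g (f i j)) k d"
proof -
  have 0: "g 0 = 0" using assms[of 0 0] by simp
  have s: "g (sum F A) = (\<Sum>a\<in>A. g (F a))" for F and A :: "int set"
    using assms 0 by (induction A rule: infinite_finite_induct) auto
  have m: "g (- x) = - g x" for x using assms[of x "- x"] 0 by (simp add: eq_neg_iff_add_eq_0 add.commute)
  show ?thesis by (simp add: exchange_sum_def s m)
qed

context affine_hecke begin

section \<open>Commutativity of the lattice elements\<close>

lemma h_left: "x * (h * y) = h * (x * y)"
  by (metis h_central mult.assoc)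

text \<open>Since \<open>Y 1 = u * T 1\<close> and \<open>Y 2 = Ti 1 * u\<close>, one product is
  \<open>u * u\<close> and the other its conjugate by \<open>T 1\<close>; so the claim is that
  \<open>T 1\<close> commutes with \<open>u * u\<close>.\<close>

lemma Y_1_2_commute: assumes "2 \<le> n" shows "Y 1 * Y 2 = Y 2 * Y 1"
proof -
  define u where "u = Om * Tdn 2 n"
  have Y1: "Y 1 = u * T 1"
    using Tdn_last[of 1 n] assms by (simp add: Y_def u_def Tidn_def mult.assoc numeral_2_eq_2)
  have Y2: "Y 2 = Ti 1 * u" by (simp add: Y_def u_def Tidn_def mult.assoc numeral_2_eq_2)
  have D: "Tdn 2 n * Om = Om * Tdn 1 (n - 1)"
    using Om_Tdn[of 1 "n - 1"] assms by (simp add: numeral_2_eq_2)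
  \<comment> \<open>Every factor of \<open>Tdn 2 n\<close> passes through \<open>Tdn 1 n\<close>
    with its index lowered by one.\<close>
  have E: "Tdn 1 n * Tdn 2 n = Tdn 1 (n - 1) * Tdn 1 n"
  proof -
    have "Tdn 1 n * Tdn 2 n = prod_list (map (\<lambda>l. T (l - 1)) (rev [2..<n])) * Tdn 1 n"
      unfolding Tdn_def[of 2] by (rule commute_prod_list) (use Tdn_shift in auto)
    moreover have "map (\<lambda>l. T (l - 1)) (rev [2..<n]) = map T (rev [1..<n - 1])"
      by (rule nth_equalityI) (auto simp: rev_nth)
    ultimately show ?thesis by (simp add: Tdn_def)
  qed
  \<comment> \<open>Moving right past the two factors \<open>Om\<close>, \<open>T 1\<close> becomes
    \<open>T 0\<close> and then \<open>T (n - 1)\<close>, which completes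
    \<open>Tdn 1 (n - 1)\<close> to \<open>Tdn 1 n\<close>; \<open>E\<close> and \<open>D\<close>
    then restore \<open>u * u\<close> with \<open>T 1\<close> on the right.\<close>
  have "T 1 * (u * u) = (T 1 * Om) * (Tdn 2 n * Om) * Tdn 2 n" by (simp add: u_def mult.assoc)
  also have "\<dots> = Om * (T 0 * Om) * Tdn 1 (n - 1) * Tdn 2 n"
    using Om_T_Suc[of 0, symmetric] assms by (simp add: D mult.assoc[symmetric])
  also have "\<dots> = Om * Om * (T (n - 1) * Tdn 1 (n - 1)) * Tdn 2 n"
    using Om_T_last[symmetric] assms by (simp add: mult.assoc[symmetric])
  also have "T (n - 1) * Tdn 1 (n - 1) = Tdn 1 n"
    using Tdn_Suc[of 1 "n - 1"] assms by simp
  also have "Om * Om * Tdn 1 n * Tdn 2 n = Om * Om * (Tdn 1 (n - 1) * Tdn 1 n)"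
    using E by (simp add: mult.assoc)
  also have "\<dots> = Om * (Tdn 2 n * Om) * Tdn 1 n" by (simp add: D mult.assoc)
  also have "Tdn 1 n = Tdn 2 n * T 1" using Tdn_last[of 1 n] assms by (simp add: numeral_2_eq_2)
  also have "Om * (Tdn 2 n * Om) * (Tdn 2 n * T 1) = u * u * T 1" by (simp add: u_def mult.assoc)
  finally have c: "T 1 * (u * u) = u * u * T 1" .
  have "Y 1 * Y 2 = u * (T 1 * Ti 1) * u" by (simp only: Y1 Y2 mult.assoc)
  also have "\<dots> = (Ti 1 * T 1) * (u * u)" using assms T_Ti[of 1] Ti_T[of 1] by simp
  also have "\<dots> = Ti 1 * (u * u * T 1)" using c by (simp add: mult.assoc)
  finally show ?thesis by (simp only: Y1 Y2 mult.assoc)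
qed

lemma Ti_commute:
  assumes "1 \<le> l" "l < n" "x * T l = T l * x" shows "x * Ti l = Ti l * x"
  by (rule commute_inverse[OF assms(3)]) (use T_Ti[of l] Ti_T[of l] assms in auto)

lemma Y_Suc_eq: assumes "1 \<le> i" "i < n" shows "Y (i + 1) = Ti i * Y i * Ti i"
proof -
  have "Ti i * Y i * Ti i = (Ti i * T i) * Y (i + 1) * (T i * Ti i)"
    by (simp add: Y_Suc[OF assms, symmetric] mult.assoc)
  then show ?thesis using T_Ti[of i] Ti_T[of i] assms by simp
qed

text \<open>Starting from \<open>Y 1 * Y 2\<close>, first the larger index is raised with the
  smaller one equal to 1, then the smaller index is raised.\<close>

lemma Y_commute_less: "1 \<le> i \<Longrightarrow> i < j \<Longrightarrow> j \<le> n \<Longrightarrow> Y i * Y j = Y j * Y i"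
proof (induction i arbitrary: j)
  case (Suc i)
  \<comment> \<open>As \<open>Y (l + 1) = Ti l * Y l * Ti l\<close>, whatever commutes with
    \<open>Y l\<close> and \<open>T l\<close> commutes with \<open>Y (l + 1)\<close>.\<close>
  have Y_step: "x * Y (l + 1) = Y (l + 1) * x"
    if "x * Y l = Y l * x" "x * T l = T l * x" "1 \<le> l" "l < n" for x l
  proof -
    have "x * Ti l = Ti l * x" using Ti_commute that by auto
    then show ?thesis unfolding Y_Suc_eq[OF that(3,4)]
      using that(1) by (intro commute_mult) 
  qed
  show ?case
  proof (cases "i = 0")
    case True
    have "Y 1 * Y j = Y j * Y 1" if "2 \<le> j" "j \<le> n" for j
      using that
    proof (induction j rule: dec_induct)
      case base
      then show ?case using Y_1_2_commute Suc.prems True by auto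
    next
      case (step k)
      then show ?case using Y_step[of "Y 1" k] T_Y[of 1 k] by auto
    qed
    then show ?thesis using True Suc.prems by auto
  next
    case False
    have "Y j * Y i = Y i * Y j" using Suc.IH[of j] Suc.prems False by auto
    moreover have "Y j * T i = T i * Y j" using T_Y[of j i] Suc.prems False by auto
    ultimately show ?thesis using Y_step[of "Y j" i] Suc.prems False by auto
  qed
qed simp

lemma Y_commute: "1 \<le> i \<Longrightarrow> i \<le> n \<Longrightarrow> 1 \<le> j \<Longrightarrow> j \<le> n \<Longrightarrow> Y i * Y j = Y j * Y i"
  using Y_commute_less[of i j] Y_commute_less[of j i] by (cases i j rule: linorder_cases) auto

section \<open>Integer powers and the exchange formula\<close>

definition Yp :: "nat \<Rightarrow> int \<Rightarrow> 'a" where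
  "Yp i d = (if 0 \<le> d then Y i ^ nat d else Yi i ^ nat (- d))"

lemma Yp_0 [simp]: "Yp i 0 = 1" by (simp add: Yp_def)

lemma Yp_Suc: assumes "1 \<le> i" "i \<le> n" shows "Yp i (d + 1) = Y i * Yp i d"
proof (cases "0 \<le> d")
  case True
  then show ?thesis by (simp add: Yp_def nat_add_distrib)
next
  case False
  then have "d = - int (nat (- d - 1)) - 1" by simp
  then obtain k where k: "d = - int k - 1" by blast
  have "Y i * (Yi i * Yi i ^ k) = Yi i ^ k"
    using Y_Yi[OF assms] by (simp add: mult.assoc[symmetric])
  then show ?thesis by (cases "k = 0") (simp_all add: Yp_def k nat_add_distrib)
qed

lemma Yp_pred: assumes "1 \<le> i" "i \<le> n" shows "Yp i (d - 1) = Yi i * Yp i d"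
  using Yp_Suc[OF assms, of "d - 1"] Y_Yi[OF assms] by (simp add: mult.assoc[symmetric])

lemma Yp_commute:
  assumes "1 \<le> i" "i \<le> n" "x * Y i = Y i * x" shows "x * Yp i d = Yp i d * x"
proof -
  have "x * Yi i = Yi i * x"
    using commute_inverse[OF assms(3)] Y_Yi[OF assms(1,2)] by auto
  then show ?thesis using assms(3) by (simp add: Yp_def commute_power)
qed

lemma Yp_Y_commute: 
  assumes "1 \<le> i" "i \<le> n" "1 \<le> j" "j \<le> n" shows "Yp i d * Y j = Y j * Yp i d"
  using Yp_commute[OF assms(1,2) Y_commute[OF assms(3,4,1,2)]] by simp

lemma Y_Ti: assumes "1 \<le> p" "p < n" shows "Y p * Ti p = Ti p * Y (p + 1) + h * Y (p + 1)"
proof -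
  have "Y p * Ti p = T p * Y (p + 1) * (T p * Ti p)" 
    by (simp add: Y_Suc[OF assms, symmetric] mult.assoc)
  moreover have "T p = Ti p + h" using Ti_eq[OF assms] by simp
  ultimately show ?thesis using T_Ti[of p] assms by (simp add: distrib_right)
qed

text \<open>With \<open>Y p = T p * Y (p + 1) * T p\<close> and commutativity, both sides become the
  alternating product of \<open>T p\<close>, \<open>Y (p + 1)\<close>, \<open>T p\<close>,
  \<open>Y (p + 1)\<close>, \<open>T p\<close>.\<close>

lemma Y_Y_T_commute: assumes "1 \<le> p" "p < n" shows "Y p * Y (p + 1) * T p = T p * (Y p * Y (p + 1))"
proof -
  have "T p * (Y p * Y (p + 1)) = T p * (Y (p + 1) * Y p)" using Y_commute[of p "p+1"] assms by simp
  also have "\<dots> = T p * (Y (p + 1) * (T p * Y (p + 1) * T p))" using Y_Suc[OF assms] by simp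
  also have "\<dots> = (T p * Y (p + 1) * T p) * Y (p + 1) * T p" by (simp add: mult.assoc)
  finally show ?thesis using Y_Suc[OF assms] by simp
qed

text \<open>The case \<open>k = d\<close> of the exchange formula. Induction in both directions
  multiplies by \<open>Y p * Y (p + 1)\<close> or by its inverse, and \<open>Ti p\<close> commutes
  with both.\<close>

lemma Yp_Yp_Ti_commute:
  assumes "1 \<le> p" "p < n"
  shows "Yp p d * Yp (p + 1) d * Ti p = Ti p * (Yp p d * Yp (p + 1) d)"
proof -
  have p: "1 \<le> p" "p \<le> n" "1 \<le> p + 1" "p + 1 \<le> n" using assms by auto
  let ?c = "Y p * Y (p + 1)" and ?c' = "Yi (p + 1) * Yi p"
  have c: "Ti p * ?c = ?c * Ti p"
    using Ti_commute[OF assms Y_Y_T_commute[OF assms]] by simp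
  have cc: "?c * ?c' = 1" "?c' * ?c = 1"
  proof -
    have "?c * ?c' = Y p * (Y (p + 1) * Yi (p + 1)) * Yi p" by (simp add: mult.assoc)
    then show "?c * ?c' = 1" using Y_Yi[OF p(1,2)] Y_Yi[OF p(3,4)] by simp
    have "?c' * ?c = Yi (p + 1) * (Yi p * Y p) * Y (p + 1)" by (simp add: mult.assoc)
    then show "?c' * ?c = 1" using Y_Yi[OF p(1,2)] Y_Yi[OF p(3,4)] by simp
  qed
  have c': "Ti p * ?c' = ?c' * Ti p" by (rule commute_inverse[OF c cc])
  have step: "Yp p (d + 1) * Yp (p + 1) (d + 1) = ?c * (Yp p d * Yp (p + 1) d)" for d
    using Yp_Suc[OF p(1,2), of d] Yp_Suc[OF p(3,4), of d] Yp_Y_commute[OF p(1,2,3,4), of d]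
    by (metis mult.assoc)
  have step': "Yp p (d - 1) * Yp (p + 1) (d - 1) = ?c' * (Yp p d * Yp (p + 1) d)" for d
  proof -
    have "?c' * (Yp p d * Yp (p + 1) d) = ?c' * ?c * (Yp p (d - 1) * Yp (p + 1) (d - 1))"
      using step[of "d - 1"] by (simp add: mult.assoc)
    then show ?thesis using cc by simp
  qed
  have "Ti p * (Yp p d * Yp (p + 1) d) = Yp p d * Yp (p + 1) d * Ti p"
  proof (induction d rule: int_induct[of _ 0])
    case base
    then show ?case by simp
  next
    case (step1 i)
    show ?case unfolding step by (rule commute_mult[OF c step1(2)])
  next
    case (step2 i)
    show ?case unfolding step' by (rule commute_mult[OF c' step2(2)])
  qed
  then show ?thesis by simp
qed

text \<open>The Bernstein-Lusztig relation with its divided difference written out as a sum.\<close>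

lemma Yp_exchange:
  assumes "1 \<le> p" "p < n"
  shows "Yp p k * Yp (p + 1) d * Ti p =
    Ti p * (Yp p d * Yp (p + 1) k) + h * exchange_sum (\<lambda>i j. Yp p i * Yp (p + 1) j) k d"
proof -
  have p: "1 \<le> p" "p \<le> n" "1 \<le> p + 1" "p + 1 \<le> n" using assms by auto
  define f where "f i j = Yp p i * Yp (p + 1) j" for i j
  \<comment> \<open>The defect satisfies \<open>D (k + 1) = Y p * D k\<close> for every integer \<open>k\<close> and vanishes at \<open>k = d\<close>,
    which settles both signs of \<open>k - d\<close> at once.\<close>
  define D where "D k = f k d * Ti p - Ti p * f d k - h * exchange_sum f k d" for k
  \<comment> \<open>Inside this proof \<open>phi1_word\<close> and \<open>phi2_word\<close> are only
    labels for the recursions in the first and second exponent; the skein word maps of the same name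
    come later.\<close>
  have phi1_word: "f (i + 1) j = Y p * f i j" for i j
    unfolding f_def Yp_Suc[OF p(1,2)] mult.assoc ..
  have phi2_word: "f i (j + 1) = Y (p + 1) * f i j" for i j
  proof -
    have "f i (j + 1) = Yp p i * Y (p + 1) * Yp (p + 1) j"
      by (simp only: f_def Yp_Suc[OF p(3,4)] mult.assoc)
    also have "Yp p i * Y (p + 1) = Y (p + 1) * Yp p i" by (rule Yp_Y_commute[OF p])
    finally show ?thesis by (simp only: f_def mult.assoc)
  qed
  have D: "D (k + 1) = Y p * D k" for k
  proof -
    have "Y p * D k = f (k + 1) d * Ti p - (Y p * Ti p) * f d k - h * (Y p * exchange_sum f k d)"
      by (simp add: D_def right_diff_distrib phi1_word h_left mult.assoc)
    also have "(Y p * Ti p) * f d k = Ti p * f d (k + 1) + h * f d (k + 1)"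
      by (simp add: Y_Ti[OF assms] distrib_right phi2_word mult.assoc)
    also have "Y p * exchange_sum f k d = exchange_sum (\<lambda>i j. f (i + 1) j) k d"
      unfolding phi1_word by (rule exchange_sum_additive) (simp add: distrib_left)
    finally show ?thesis by (simp add: D_def exchange_sum_Suc distrib_left)
  qed
  have D': "D (k - 1) = Yi p * D k" for k
    using D[of "k - 1"] Y_Yi[OF p(1,2)] by (simp add: mult.assoc[symmetric])
  have "D k = 0"
  proof (induction k rule: int_induct[of _ d])
    case base
    then show ?case using Yp_Yp_Ti_commute[OF assms] by (simp add: D_def f_def)
  next
    case (step1 i)
    then show ?case by (simp add: D)
  next
    case (step2 i)
    then show ?case by (simp add: D')
  qed
  moreover have "f = (\<lambda>i j. Yp p i * Yp (p + 1) j)" by (intro ext) (simp add: f_def)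
  ultimately show ?thesis by (simp add: D_def diff_diff_eq)
qed

section \<open>Monomials in the lattice elements of the strands after \<open>m\<close>\<close>

fun Ymon :: "nat \<Rightarrow> int list \<Rightarrow> 'a" where
  "Ymon m [] = 1"
| "Ymon m (d # D) = Yp (m + 1) d * Ymon (m + 1) D"

lemma Ymon_append: "Ymon m (D @ E) = Ymon m D * Ymon (m + length D) E"
  by (induction D arbitrary: m) (simp_all add: mult.assoc)

lemma Ymon_commute:
  assumes "m + length D \<le> n" "\<And>i. m < i \<Longrightarrow> i \<le> m + length D \<Longrightarrow> x * Y i = Y i * x"
  shows "x * Ymon m D = Ymon m D * x"
  using assms
proof (induction D arbitrary: m)
  case (Cons d D)
  have "x * Yp (m + 1) d = Yp (m + 1) d * x" using Cons.prems by (intro Yp_commute) auto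
  moreover have "x * Ymon (m + 1) D = Ymon (m + 1) D * x" using Cons.prems by (intro Cons.IH) auto
  ultimately show ?case by (simp add: commute_mult)
qed simp

text \<open>\<open>Ti p\<close> commutes with every \<open>Y i\<close> except those with
  \<open>i = p\<close> and \<open>i = p + 1\<close>, so the formula for two strands extends to whole
  monomials.\<close>

lemma Ymon_exchange:
  assumes "length (D @ [k, d] @ E) \<le> n" "p = length D + 1"
  shows "Ymon 0 (D @ [k, d] @ E) * Ti p =
    Ti p * Ymon 0 (D @ [d, k] @ E) + h * exchange_sum (\<lambda>i j. Ymon 0 (D @ [i, j] @ E)) k d"
proof -
  have p: "1 \<le> p" "p < n" using assms by auto
  have e: "Ymon 0 (D @ [i, j] @ E) = Ymon 0 D * (Yp p i * Yp (p + 1) j) * Ymon (p + 1) E" for i j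
    using assms by (simp add: Ymon_append mult.assoc)
  have tD: "Ti p * Ymon 0 D = Ymon 0 D * Ti p"
    by (rule Ymon_commute) (use assms p in \<open>auto intro!: Ti_commute[symmetric] T_Y[symmetric]\<close>)
  have tE: "Ti p * Ymon (p + 1) E = Ymon (p + 1) E * Ti p"
    by (rule Ymon_commute) (use assms p in \<open>auto intro!: Ti_commute[symmetric] T_Y[symmetric]\<close>)
  have "Ymon 0 (D @ [k, d] @ E) * Ti p = Ymon 0 D * (Yp p k * Yp (p + 1) d * Ti p) * Ymon (p + 1) E"
    by (simp only: e mult.assoc tE)
  also have "\<dots> = Ymon 0 D * Ti p * (Yp p d * Yp (p + 1) k) * Ymon (p + 1) E
      + h * (Ymon 0 D * exchange_sum (\<lambda>i j. Yp p i * Yp (p + 1) j) k d * Ymon (p + 1) E)"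
    unfolding Yp_exchange[OF p] distrib_left distrib_right
    by (simp add: mult.assoc h_left)
  also have "Ymon 0 D * exchange_sum (\<lambda>i j. Yp p i * Yp (p + 1) j) k d * Ymon (p + 1) E
      = exchange_sum (\<lambda>i j. Ymon 0 (D @ [i, j] @ E)) k d"
    unfolding e by (rule exchange_sum_additive) (simp add: distrib_left distrib_right)
  finally show ?thesis by (simp only: e tD[symmetric] mult.assoc)
qed

end

section \<open>The defining relations in the cocenter\<close>

context affine_hecke begin

text \<open>This is T_J for consecutive blocks that begin after strand \<open>m\<close>: only the
  lengths of the entries matter, and at each boundary between two blocks one \<open>T\<close> is
  missing.\<close>

fun Tblocks :: "nat \<Rightarrow> 'b list list \<Rightarrow> 'a" where
  "Tblocks m [] = 1"
| "Tblocks m (e # u) = Tup (m + 1) (m + length e) * Tblocks (m + length e) u"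

lemma Tblocks_append: "Tblocks m (u @ v) = Tblocks m u * Tblocks (m + length (concat u)) v"
  by (induction u arbitrary: m) (simp_all add: mult.assoc add.assoc)

lemma Tblocks_commute:
  assumes "m + length (concat u) \<le> n"
    "\<And>l. m < l \<Longrightarrow> l < m + length (concat u) \<Longrightarrow> x * T l = T l * x"
  shows "x * Tblocks m u = Tblocks m u * x"
  using assms
proof (induction u arbitrary: m)
  case (Cons e u)
  have "x * Tup (m + 1) (m + length e) = Tup (m + 1) (m + length e) * x"
    unfolding Tup_def by (rule commute_prod_list) (use Cons.prems in auto)
  moreover have "x * Tblocks (m + length e) u = Tblocks (m + length e) u * x"
    using Cons.prems by (intro Cons.IH) auto
  ultimately show ?case by (simp add: commute_mult)
qed simp

lemma T_Tblocks_commute: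
  assumes "1 \<le> l" "l < n" "l < m \<or> m + length (concat u) < l" "m + length (concat u) \<le> n"
  shows "T l * Tblocks m u = Tblocks m u * T l"
  by (rule Tblocks_commute) (use assms in \<open>auto intro!: T_far\<close>)

lemma Y_Tblocks_commute:
  assumes "1 \<le> i" "i \<le> n" "i \<le> m \<or> m + length (concat u) < i" "m + length (concat u) \<le> n"
  shows "Y i * Tblocks m u = Tblocks m u * Y i"
  by (rule Tblocks_commute) (use assms in \<open>auto intro!: T_Y[symmetric]\<close>)

text \<open>The image of a product of generators, up to its power of q.\<close>

definition Estd :: "int list list \<Rightarrow> 'a" where
  "Estd u = Ymon 0 (concat u) * Tblocks 0 u"

end

text \<open>\<open>K\<close> stands for the kernel of the projection to the cocenter; its use below
  is to move factors cyclically.\<close>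

locale affine_hecke_trace = affine_hecke +
  fixes K :: "'a set"
  assumes K_0: "0 \<in> K"
    and K_add: "x \<in> K \<Longrightarrow> y \<in> K \<Longrightarrow> x + y \<in> K"
    and K_commutator: "x * y - y * x \<in> K"
begin

text \<open>In the second word \<open>Y (p + 1)\<close> travels to the right: past \<open>L\<close>,
  through \<open>T p\<close>, where it becomes \<open>Y p\<close> and leaves \<open>Ti p\<close>,
  past \<open>R\<close>, and then cyclically to the front. What remains is
  \<open>T p - Ti p = h\<close>, and deleting \<open>T p\<close> is exactly the splitting of the
  block.\<close>

lemma Estd_relation1:
  assumes "length (concat (x @ [a @ [s, t] @ b] @ y)) = n"
  shows "Estd (x @ [a @ [s, t] @ b] @ y) - Estd (x @ [a @ [s - 1, t + 1] @ b] @ y)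
     - h * Estd (x @ [a @ [s], [t] @ b] @ y) \<in> K"
proof -
  define m where "m = length (concat x)"
  define p where "p = m + length a + 1"
  define q where "q = p + 1 + length b"
  define L where "L = Tblocks 0 x * Tup (m + 1) p"
  define R where "R = Tup (p + 1) q * Tblocks q y"
  \<comment> \<open>The common monomial: the first word begins with \<open>Y p * M\<close>, the
    second with \<open>M * Y (p + 1)\<close>.\<close>
  define M where "M = Ymon 0 (concat x @ a @ [s - 1, t] @ concat (b # y))"
  have n: "n = q + length (concat y)" using assms by (simp add: m_def p_def q_def)
  have qn: "q \<le> n" by (simp add: n)
  have p: "1 \<le> p" "p < n" "p \<le> n" "1 \<le> p + 1" "p + 1 \<le> n"
    by (auto simp: n q_def p_def)
  have TT12: "Tblocks 0 (x @ [a @ [c, d] @ b] @ y) = L * T p * R" for c d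
  proof -
    have "Tup (m + 1) q = Tup (m + 1) p * (T p * Tup (p + 1) q)"
      using Tup_split[of "m + 1" p q] Tup_Suc[of p q] by (simp add: p_def q_def)
    then show ?thesis
      by (simp add: Tblocks_append m_def[symmetric] L_def R_def mult.assoc p_def q_def add.assoc)
  qed
  have TT3: "Tblocks 0 (x @ [a @ [s], [t] @ b] @ y) = L * R"
    by (simp add: Tblocks_append m_def[symmetric] L_def R_def mult.assoc p_def q_def add.assoc)
  have M0: "Ymon 0 (concat x @ a @ [c, d] @ concat (b # y))
     = Ymon 0 (concat x @ a) * (Yp p c * Yp (p + 1) d) * Ymon (p + 1) (concat (b # y))" for c d
    by (simp add: Ymon_append m_def[symmetric] p_def mult.assoc add.assoc)
  have YD: "Ymon 0 (concat x @ a @ [s, t] @ concat (b # y)) = Y p * M"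
  proof -
    have "Y p * Ymon 0 (concat x @ a) = Ymon 0 (concat x @ a) * Y p"
      by (rule Ymon_commute) (use p in \<open>auto intro!: Y_commute simp: m_def p_def\<close>)
    then show ?thesis unfolding M_def M0 using Yp_Suc[OF p(1,3), of "s - 1"]
      by (simp add: mult.assoc[symmetric])
  qed
  have Ymon: "Y i * M = M * Y i" if "1 \<le> i" "i \<le> n" for i
    unfolding M_def
  proof (rule Ymon_commute)
    show len: "0 + length (concat x @ a @ [s - 1, t] @ concat (b # y)) \<le> n" using assms by simp
    fix j assume "0 < j" "j \<le> 0 + length (concat x @ a @ [s - 1, t] @ concat (b # y))"
    then have "1 \<le> j" "j \<le> n" using len by linarith+
    then show "Y i * Y j = Y j * Y i" using Y_commute[OF that] by blast
  qed
  have YD': "Ymon 0 (concat x @ a @ [s - 1, t + 1] @ concat (b # y)) = M * Y (p + 1)"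
  proof -
    let ?A = "Ymon 0 (concat x @ a)" and ?E = "Ymon (p + 1) (concat (b # y))"
    have A: "Y (p + 1) * ?A = ?A * Y (p + 1)"
      by (rule Ymon_commute) (use p in \<open>auto intro!: Y_commute simp: m_def p_def\<close>)
    have B: "Yp p (s - 1) * Y (p + 1) = Y (p + 1) * Yp p (s - 1)"
      using Yp_Y_commute p by auto
    have "Ymon 0 (concat x @ a @ [s - 1, t + 1] @ concat (b # y))
        = ?A * (Yp p (s - 1) * Y (p + 1)) * Yp (p + 1) t * ?E"
      unfolding M0 Yp_Suc[OF p(4,5), of t] by (simp only: mult.assoc)
    also have "\<dots> = ?A * Y (p + 1) * Yp p (s - 1) * Yp (p + 1) t * ?E"
      by (simp only: B mult.assoc)
    also have "\<dots> = Y (p + 1) * M"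
      unfolding M_def M0 A[symmetric] by (simp only: mult.assoc)
    finally show ?thesis using Ymon p by simp
  qed
  have YL: "Y (p + 1) * L = L * Y (p + 1)"
    unfolding L_def
  proof (rule commute_mult)
    show "Y (p + 1) * Tblocks 0 x = Tblocks 0 x * Y (p + 1)"
      by (rule Y_Tblocks_commute) (use p in \<open>auto simp: p_def m_def\<close>)
    show "Y (p + 1) * Tup (m + 1) p = Tup (m + 1) p * Y (p + 1)"
      unfolding Tup_def by (rule commute_prod_list) (use p in \<open>auto intro!: T_Y[symmetric]\<close>)
  qed
  have YR: "Y p * R = R * Y p"
    unfolding R_def
  proof (rule commute_mult)
    show "Y p * Tblocks q y = Tblocks q y * Y p"
      by (rule Y_Tblocks_commute) (use p n in \<open>simp_all add: q_def\<close>)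
    show "Y p * Tup (p + 1) q = Tup (p + 1) q * Y p"
      unfolding Tup_def by (rule commute_prod_list) (use p qn in \<open>auto intro!: T_Y[symmetric]\<close>)
  qed
  have TiY: "Y (p + 1) * T p = Ti p * Y p"
  proof -
    have "Ti p * Y p = (Ti p * T p) * (Y (p + 1) * T p)"
      by (simp add: Y_Suc[OF p(1,2), symmetric] mult.assoc)
    then show ?thesis using Ti_T[of p] p by simp
  qed
  have "M * Y (p + 1) * (L * T p * R) = M * (Y (p + 1) * L) * T p * R" by (simp add: mult.assoc)
  also have "\<dots> = M * L * (Y (p + 1) * T p) * R" by (simp only: YL mult.assoc)
  also have "\<dots> = M * L * Ti p * (Y p * R)" by (simp only: TiY mult.assoc)
  also have "\<dots> = M * L * Ti p * R * Y p" by (simp only: YR mult.assoc)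
  finally have 1: "M * Y (p + 1) * (L * T p * R) = M * L * Ti p * R * Y p" .
  have "Y p * M * (L * T p * R) - M * Y (p + 1) * (L * T p * R) - h * (Y p * M * (L * R))
     = Y p * (M * L * Ti p * R) - (M * L * Ti p * R) * Y p"
    unfolding 1 by (simp add: Ti_eq[OF p(1,2)] algebra_simps h_left)
  also have "\<dots> \<in> K" by (rule K_commutator)
  finally show ?thesis
    using YD YD' by (simp only: Estd_def TT12 TT3) (simp add: mult.assoc)
qed

text \<open>A telescoping sum over the positions of \<open>k\<close> inside the block. Each move
  costs one commutator and one summand \<open>h * cc j\<close>.\<close>

lemma Estd_relation2:
  assumes n: "length (concat (x @ [[k], d] @ y)) = n" and d: "d \<noteq> []"
  shows "Estd (x @ [[k], d] @ y) - Estd (x @ [d, [k]] @ y)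
     - h * (\<Sum>i<length d. exchange_sum (\<lambda>s t. Estd (x @ [take i d @ [s, t] @ drop (i + 1) d] @ y)) k (d ! i)) \<in> K"
proof -
  define m where "m = length (concat x)"
  define l where "l = length d"
  define X where "X = Tblocks 0 x"
  define Z where "Z = Tblocks (m + l + 1) y"
  define C where "C = Tup (m + 1) (m + l + 1)"
  \<comment> \<open>In \<open>P j\<close> the exponent \<open>k\<close> stands after
    \<open>j\<close> entries of \<open>d\<close>, while \<open>C\<close> treats all
    \<open>l + 1\<close> strands as one block. Splitting off the first strand means
    \<open>Ti (m + 1) * C\<close>, splitting off the last one \<open>C * Ti (m + l)\<close>.\<close>
  define P where "P j = Ymon 0 (concat x @ take j d @ [k] @ drop j d @ concat y)" for j
  define cc where "cc j = exchange_sum (\<lambda>s t. Estd (x @ [take j d @ [s, t] @ drop (j + 1) d] @ y)) k (d ! j)" for j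
  have l: "1 \<le> l" using d by (cases d) (auto simp: l_def)
  have n: "n = m + l + 1 + length (concat y)" using n by (simp add: m_def l_def)
  have X: "X * Ti q = Ti q * X" if "m < q" "q \<le> m + l" for q
    unfolding X_def using that n
    by (intro Ti_commute) (auto intro!: T_Tblocks_commute[symmetric] simp: m_def)
  have Z: "Z * Ti q = Ti q * Z" if "m < q" "q \<le> m + l" for q
    unfolding Z_def using that n
    by (intro Ti_commute) (auto intro!: T_Tblocks_commute[symmetric] simp: m_def)
  \<comment> \<open>The exchange formula brings the inverse to the very front, and cyclicity moves
    it to the very end, from where it passes \<open>Z\<close> and stops behind
    \<open>C\<close>.\<close>
  have step: "P j * X * Ti (m + j + 1) * C * Z - P (j + 1) * X * C * Ti (m + j + 1) * Z - h * cc j \<in> K"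
    if j: "j < l" for j
  proof -
    define q where "q = m + j + 1"
    define D where "D = concat x @ take j d"
    define E where "E = drop (j + 1) d @ concat y"
    have q: "m < q" "q \<le> m + l" "q = length D + 1" "length (D @ [k, d ! j] @ E) \<le> n"
      using j n by (auto simp: q_def D_def E_def l_def m_def)
    have P: "P j = Ymon 0 (D @ [k, d ! j] @ E)"
      unfolding P_def D_def E_def using j by (simp add: l_def Cons_nth_drop_Suc[symmetric])
    have P': "P (j + 1) = Ymon 0 (D @ [d ! j, k] @ E)"
      unfolding P_def D_def E_def using j take_Suc_conv_app_nth[of j d] by (simp add: l_def)
    have "cc j = exchange_sum (\<lambda>s t. Ymon 0 (D @ [s, t] @ E) * (X * C * Z)) k (d ! j)"
    proof -
      have "Estd (x @ [take j d @ [s, t] @ drop (j + 1) d] @ y) = Ymon 0 (D @ [s, t] @ E) * (X * C * Z)" for s t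
        using j by (simp add: Estd_def Tblocks_append X_def C_def Z_def D_def E_def m_def[symmetric] l_def mult.assoc
            Suc_diff_Suc min_def)
      then show ?thesis by (simp add: cc_def)
    qed
    also have "\<dots> = exchange_sum (\<lambda>s t. Ymon 0 (D @ [s, t] @ E)) k (d ! j) * (X * C * Z)"
      by (rule exchange_sum_additive[symmetric]) (simp add: distrib_right)
    finally have c: "cc j = exchange_sum (\<lambda>s t. Ymon 0 (D @ [s, t] @ E)) k (d ! j) * (X * C * Z)" .
    have "P j * X * Ti q * C * Z = P j * (X * Ti q) * C * Z" by (simp only: mult.assoc)
    also have "\<dots> = P j * Ti q * (X * C * Z)" by (simp only: X[OF q(1,2)] mult.assoc)
    also have "P j * Ti q * (X * C * Z) = Ti q * (P (j + 1) * (X * C * Z)) + h * cc j"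
      unfolding P P' c Ymon_exchange[OF q(4,3)] by (simp add: distrib_right mult.assoc)
    finally have 1: "P j * X * Ti q * C * Z = Ti q * (P (j + 1) * (X * C * Z)) + h * cc j" .
    have 2: "P (j + 1) * X * C * Ti q * Z = (P (j + 1) * (X * C * Z)) * Ti q"
      by (simp only: Z[OF q(1,2)] mult.assoc)
    show ?thesis using K_commutator[of "Ti q" "P (j + 1) * (X * C * Z)"]
      unfolding q_def[symmetric] 1 2 by simp
  qed
  \<comment> \<open>Passing back through \<open>C\<close> raises the index by one, which is the
    position of the inverse required by the next step.\<close>
  have shift: "C * Ti (m + j + 1) = Ti (m + (j + 1) + 1) * C" if "j + 1 < l" for j
    unfolding C_def
    by (rule commute_inverse[OF Tup_shift]) (use that n T_Ti[of "m+j+1"] Ti_T[of "m+(j+1)+1"] in auto)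
  have "P 0 * X * Ti (m + 1) * C * Z - P (j + 1) * X * C * Ti (m + j + 1) * Z - h * (\<Sum>i<j + 1. cc i) \<in> K"
    if "j < l" for j
    using that
  proof (induction j)
    case 0
    then show ?case using step[of 0] by simp
  next
    case (Suc j)
    have "P (j + 1) * X * C * Ti (m + j + 1) * Z = P (j + 1) * X * Ti (m + (j + 1) + 1) * C * Z"
      using shift[of j] Suc.prems by (simp add: mult.assoc[symmetric]) (simp add: mult.assoc)
    then have "P 0 * X * Ti (m + 1) * C * Z - P (j + 1) * X * Ti (m + (j + 1) + 1) * C * Z - h * (\<Sum>i<j + 1. cc i) \<in> K"
      using Suc by simp
    from K_add[OF this step[of "j + 1"]] show ?case using Suc.prems by (simp add: algebra_simps)
  qed
  from this[of "l - 1"] have fin: "P 0 * X * Ti (m + 1) * C * Z - P l * X * C * Ti (m + l) * Z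
    - h * (\<Sum>i<l. cc i) \<in> K" using l by simp
  have "Ti (m + 1) * C = Tup (m + 2) (m + l + 1)"
  proof -
    have "Ti (m + 1) * C = (Ti (m + 1) * T (m + 1)) * Tup (m + 2) (m + l + 1)"
      using l Tup_Suc[of "m + 1" "m + l + 1"] by (simp add: C_def mult.assoc)
    then show ?thesis using Ti_T[of "m + 1"] n l by simp
  qed
  then have E1: "Estd (x @ [[k], d] @ y) = P 0 * X * Ti (m + 1) * C * Z"
    by (simp add: Estd_def P_def Tblocks_append X_def Z_def m_def[symmetric] l_def mult.assoc[symmetric])
       (simp add: mult.assoc)
  have "C * Ti (m + l) = Tup (m + 1) (m + l)"
  proof -
    have "C * Ti (m + l) = Tup (m + 1) (m + l) * (T (m + l) * Ti (m + l))"
      using l Tup_snoc[of "m + 1" "m + l"] by (simp add: C_def mult.assoc)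
    then show ?thesis using T_Ti[of "m + l"] n l by simp
  qed
  then have E2: "Estd (x @ [d, [k]] @ y) = P l * X * C * Ti (m + l) * Z"
    by (simp add: Estd_def P_def Tblocks_append X_def Z_def m_def[symmetric] l_def mult.assoc)
  show ?thesis using fin unfolding E1 E2 by (simp add: cc_def l_def)
qed

end

section \<open>Spanning the cocenter\<close>

text \<open>The scalars enter as a central ring homomorphism \<open>sc\<close>; \<open>hk\<close>
  exhibits \<open>h\<close> as a scalar, so that spans are closed under multiplication by
  \<open>h\<close>.\<close>

locale affine_hecke_algebra = affine_hecke_trace +
  fixes sc :: "'k::comm_ring_1 \<Rightarrow> 'a" and hk :: 'k
  assumes sc_1: "sc 1 = 1"
    and sc_add: "sc (c + d) = sc c + sc d"
    and sc_mult: "sc (c * d) = sc c * sc d"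
    and sc_central: "x * sc c = sc c * x"
    and sc_h: "sc hk = h"
    and K_sc: "x \<in> K \<Longrightarrow> sc c * x \<in> K"
begin

lemma sc_0: "sc 0 = 0"
  using sc_add[of 0 0] by simp

lemma sc_uminus: "sc (- c) = - sc c"
  using sc_add[of c "- c"] sc_0 by (simp add: eq_neg_iff_add_eq_0 add.commute)

lemma sc_left: "x * (sc c * y) = sc c * (x * y)"
  by (metis sc_central mult.assoc)

section \<open>Spans over the scalars and generated subalgebras\<close>

inductive_set span_sc :: "'a set \<Rightarrow> 'a set" for G where
  span_sc_zero: "0 \<in> span_sc G"
| span_sc_gen: "g \<in> G \<Longrightarrow> sc c * g \<in> span_sc G"
| span_sc_add: "x \<in> span_sc G \<Longrightarrow> y \<in> span_sc G \<Longrightarrow> x + y \<in> span_sc G"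

lemma span_sc_base: "g \<in> G \<Longrightarrow> g \<in> span_sc G"
  using span_sc_gen[of g G 1] by (simp add: sc_1)

lemma span_sc_mult:
  assumes "x \<in> span_sc G" "\<And>g. g \<in> G \<Longrightarrow> a * g * b \<in> span_sc G'"
    and "\<And>c y. y \<in> span_sc G' \<Longrightarrow> sc c * y \<in> span_sc G'"
  shows "a * x * b \<in> span_sc G'"
  using assms(1)
proof induction
  case (span_sc_gen g c)
  then show ?case using assms(3)[OF assms(2), of g c] by (simp add: sc_left mult.assoc)
qed (simp_all add: distrib_left distrib_right span_sc_zero span_sc_add)

lemma span_sc_sc: "x \<in> span_sc G \<Longrightarrow> sc c * x \<in> span_sc G"
proof (induction rule: span_sc.induct)
  case (span_sc_gen g d)
  then show ?case using span_sc.span_sc_gen[of g G "c * d"] by (simp add: sc_mult mult.assoc)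
qed (simp_all add: distrib_left span_sc_zero span_sc_add)

lemmas span_sc_context = span_sc_mult[OF _ _ span_sc_sc]

lemma span_sc_left: "x \<in> span_sc G \<Longrightarrow> (\<And>g. g \<in> G \<Longrightarrow> a * g \<in> span_sc G') \<Longrightarrow> a * x \<in> span_sc G'"
  using span_sc_context[of x G a 1 G'] by simp

lemma span_sc_uminus: "x \<in> span_sc G \<Longrightarrow> - x \<in> span_sc G"
  using span_sc_sc[of x G "- 1"] by (simp add: sc_uminus sc_1)

lemma span_sc_diff: "x \<in> span_sc G \<Longrightarrow> y \<in> span_sc G \<Longrightarrow> x - y \<in> span_sc G"
  using span_sc_add[of x G "- y"] span_sc_uminus by simp

lemma span_sc_h: "x \<in> span_sc G \<Longrightarrow> h * x \<in> span_sc G"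
  using span_sc_sc[of x G hk] by (simp add: sc_h)

lemma span_sc_sum: "(\<And>i. i \<in> A \<Longrightarrow> f i \<in> span_sc G) \<Longrightarrow> sum f A \<in> span_sc G"
  by (induction A rule: infinite_finite_induct) (simp_all add: span_sc_zero span_sc_add)

lemma span_sc_exchange_sum: "(\<And>i j. f i j \<in> span_sc G) \<Longrightarrow> exchange_sum f k d \<in> span_sc G"
  unfolding exchange_sum_def by (auto intro!: span_sc_sum span_sc_uminus)

inductive_set alg :: "'a set \<Rightarrow> 'a set" for G where
  alg_one: "1 \<in> alg G"
| alg_gen: "g \<in> G \<Longrightarrow> g \<in> alg G"
| alg_mult: "x \<in> alg G \<Longrightarrow> y \<in> alg G \<Longrightarrow> x * y \<in> alg G"
| alg_add: "x \<in> alg G \<Longrightarrow> y \<in> alg G \<Longrightarrow> x + y \<in> alg G"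
| alg_sc: "x \<in> alg G \<Longrightarrow> sc c * x \<in> alg G"

lemma alg_mono: "x \<in> alg G \<Longrightarrow> G \<subseteq> G' \<Longrightarrow> x \<in> alg G'"
  by (induction rule: alg.induct) (auto intro: alg.intros)

lemma alg_commute:
  assumes "x \<in> alg G" "\<And>g. g \<in> G \<Longrightarrow> y * g = g * y"
  shows "y * x = x * y"
  using assms(1)
proof induction
  case (alg_gen g)
  then show ?case by (rule assms(2))
next
  case (alg_mult x z)
  then show ?case by (intro commute_mult)
next
  case (alg_add x z)
  then show ?case by (simp only: distrib_left distrib_right)
next
  case (alg_sc x c)
  then show ?case by (simp only: sc_left mult.assoc)
qed simp

text \<open>Reduces stability under a subalgebra to stability under its generators; it serves both
  for \<open>Hgen\<close> and for \<open>YH\<close>.\<close>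

lemma alg_preserve:
  assumes "b \<in> alg G" "x \<in> span_sc B" "\<And>g s. g \<in> G \<Longrightarrow> s \<in> B \<Longrightarrow> g * s \<in> span_sc B"
  shows "b * x \<in> span_sc B"
  using assms(1,2)
proof (induction arbitrary: x)
  case (alg_gen g)
  then show ?case using assms(3)[of g] by (intro span_sc_left[of x B]) auto
qed (simp_all add: distrib_right mult.assoc span_sc_add span_sc_sc)

section \<open>The finite Hecke algebra on the first \<open>m\<close> strands\<close>

definition H :: "nat \<Rightarrow> 'a set" where "H m = alg (T ` {1..<m})"

lemma H_T: "1 \<le> i \<Longrightarrow> i < m \<Longrightarrow> T i \<in> H m"
  by (auto simp: H_def intro: alg_gen)

lemma H_one: "1 \<in> H m" by (simp add: H_def alg_one)

lemma H_mult: "x \<in> H m \<Longrightarrow> y \<in> H m \<Longrightarrow> x * y \<in> H m"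
  by (simp add: H_def alg_mult)

lemma H_mono: "x \<in> H m \<Longrightarrow> m \<le> m' \<Longrightarrow> x \<in> H m'"
  unfolding H_def by (erule alg_mono) auto

lemma H_commute: "b \<in> H m \<Longrightarrow> m < j \<Longrightarrow> j < n \<Longrightarrow> T j * b = b * T j"
  unfolding H_def by (erule alg_commute) (auto intro!: T_far)

definition Hgen :: "nat \<Rightarrow> 'a set" where
  "Hgen m = H m \<union> {a * T m * b | a b. a \<in> H m \<and> b \<in> H m}"

text \<open>Moving \<open>T m\<close> past an element of \<open>H m\<close> is possible for these two kinds of elements: \<open>T m\<close> commutes
  with the first, and it commutes with \<open>a\<close> and \<open>b\<close> in the second, where a braid relation finishes.\<close>
definition Hsplit :: "nat \<Rightarrow> 'a set" where
  "Hsplit m = {b \<in> H m. T m * b = b * T m}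
     \<union> {a * T (m - 1) * b | a b. 2 \<le> m \<and> a \<in> H (m - 1) \<and> b \<in> H (m - 1)}"

text \<open>The span of \<open>Hgen m\<close> contains 1 and is stable under left multiplication by
  \<open>T 1\<close> to \<open>T m\<close>, so it contains \<open>H (m + 1)\<close>. For
  \<open>i < m\<close> the factor \<open>T i\<close> is absorbed on the left; for \<open>T m\<close>
  the adjacent element of \<open>H m\<close> is first expanded in \<open>Hsplit m\<close>.\<close>

lemma H_decomp_step:
  assumes m: "1 \<le> m" "m < n" and Hsplit: "H m \<subseteq> span_sc (Hsplit m)"
  shows "H (m + 1) \<subseteq> span_sc (Hgen m)"
proof
  have V1: "b \<in> H m \<Longrightarrow> b \<in> span_sc (Hgen m)" for b by (intro span_sc_base) (auto simp: Hgen_def)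
  have V2: "a \<in> H m \<Longrightarrow> b \<in> H m \<Longrightarrow> a * T m * b \<in> span_sc (Hgen m)" for a b
    by (intro span_sc_base) (auto simp: Hgen_def)
  have Tm: "T m * w \<in> span_sc (Hgen m)" if w: "w \<in> Hsplit m" for w
  proof (cases "w \<in> H m \<and> T m * w = w * T m")
    case True
    then show ?thesis using V2[of w 1] H_one by simp
  next
    case False
    then obtain a b where ab: "w = a * T (m - 1) * b" "2 \<le> m" "a \<in> H (m - 1)" "b \<in> H (m - 1)"
      using w False unfolding Hsplit_def by blast
    have "T m * w = (T m * a) * T (m - 1) * b" by (simp add: ab mult.assoc)
    also have "T m * a = a * T m" using ab m by (intro H_commute) auto
    also have "a * T m * T (m - 1) * b = a * T m * (T (m - 1) * b)" by (simp add: mult.assoc)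
    also have "\<dots> \<in> span_sc (Hgen m)"
      using ab by (intro V2 H_mult H_T) (auto intro: H_mono)
    finally show ?thesis .
  qed
  have TmT: "T m * w * (T m * c) \<in> span_sc (Hgen m)" if w: "w \<in> Hsplit m" and "c \<in> H m" for w c
  proof (cases "w \<in> H m \<and> T m * w = w * T m")
    case True
    then have "T m * w * (T m * c) = w * (T m * T m) * c" by (simp add: mult.assoc)
    also have "\<dots> = w * c + h * (w * T m * c)"
      using T_square[of m] m by (simp add: distrib_left distrib_right h_left mult.assoc)
    also have "\<dots> \<in> span_sc (Hgen m)"
      using True that by (intro span_sc_add span_sc_h V1 V2 H_mult) auto
    finally show ?thesis .
  next
    case False
    then obtain a b where ab: "w = a * T (m - 1) * b" "2 \<le> m" "a \<in> H (m - 1)" "b \<in> H (m - 1)"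
      using w False unfolding Hsplit_def by blast
    have "T m * w * (T m * c) = (T m * a) * T (m - 1) * (b * T m) * c" by (simp add: ab mult.assoc)
    also have "T m * a = a * T m" using ab m by (intro H_commute) auto
    also have "b * T m = T m * b" using ab m by (intro H_commute[symmetric]) auto
    also have "a * T m * T (m - 1) * (T m * b) * c = a * (T m * T (m - 1) * T m) * b * c"
      by (simp add: mult.assoc)
    also have "T m * T (m - 1) * T m = T (m - 1) * T m * T (m - 1)"
      using T_braid[of "m - 1"] ab m by simp
    also have "a * (T (m - 1) * T m * T (m - 1)) * b * c = (a * T (m - 1)) * T m * (T (m - 1) * b * c)"
      by (simp add: mult.assoc)
    also have "\<dots> \<in> span_sc (Hgen m)"
      using ab that by (intro V2 H_mult H_T) (auto intro: H_mono)
    finally show ?thesis .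
  qed
  fix x assume "x \<in> H (m + 1)"
  moreover have "1 \<in> span_sc (Hgen m)" using V1 H_one by blast
  moreover have "g * s \<in> span_sc (Hgen m)" if g: "g \<in> T ` {1..<m + 1}" and s: "s \<in> Hgen m" for g s
  proof -
    obtain i where i: "g = T i" "1 \<le> i" "i \<le> m" using g by auto
    consider "s \<in> H m" | a b where "s = a * T m * b" "a \<in> H m" "b \<in> H m"
      using s by (auto simp: Hgen_def)
    then show ?thesis
    proof cases
      case 1
      show ?thesis
      proof (cases "i = m")
        case True
        show ?thesis unfolding i(1) True
          by (rule span_sc_left[of s "Hsplit m"]) (use 1 Hsplit Tm in auto)
      next
        case False
        then show ?thesis using i 1 by (intro V1) (auto intro!: H_mult H_T)
      qed
    next
      case 2
      show ?thesis
      proof (cases "i = m")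
        case True
        have "T m * a * (T m * b) \<in> span_sc (Hgen m)"
          by (rule span_sc_context[of a "Hsplit m"]) (use 2 Hsplit TmT in auto)
        then show ?thesis by (simp add: i True 2 mult.assoc)
      next
        case False
        then have "(T i * a) * T m * b \<in> span_sc (Hgen m)" using i 2 by (intro V2 H_mult H_T) auto
        then show ?thesis by (simp add: i 2 mult.assoc)
      qed
    qed
  qed
  ultimately have "x * 1 \<in> span_sc (Hgen m)" unfolding H_def by (rule alg_preserve)
  then show "x \<in> span_sc (Hgen m)" by simp
qed

lemma H_1_sc: "x \<in> H 1 \<Longrightarrow> \<exists>c. x = sc c"
  unfolding H_def
proof (induction rule: alg.induct)
  case alg_one
  show ?case using sc_1 by metis
next
  case (alg_mult x y)
  then show ?case by (metis sc_mult)
next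
  case (alg_add x y)
  then show ?case by (metis sc_add)
next
  case (alg_sc x c)
  then show ?case by (metis sc_mult)
qed simp

text \<open>The decomposition at \<open>m\<close> is the splitting hypothesis at
  \<open>m + 1\<close>, because \<open>Hgen m\<close> is contained in \<open>Hsplit (m + 1)\<close>.
  The start is \<open>H 1\<close>, which consists of scalars.\<close>

lemma H_decomp: "1 \<le> m \<Longrightarrow> m < n \<Longrightarrow> H (m + 1) \<subseteq> span_sc (Hgen m)"
proof (induction m rule: dec_induct)
  case base
  have "H 1 \<subseteq> span_sc (Hsplit 1)"
  proof
    fix x assume x: "x \<in> H 1"
    then obtain c where "x = sc c" using H_1_sc by blast
    then show "x \<in> span_sc (Hsplit 1)" using x by (intro span_sc_base) (auto simp: Hsplit_def sc_central)
  qed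
  then show ?case using base by (intro H_decomp_step) auto
next
  case (step m)
  have "Hgen m \<subseteq> Hsplit (m + 1)"
  proof
    fix x assume "x \<in> Hgen m"
    then consider "x \<in> H m" | a b where "x = a * T m * b" "a \<in> H m" "b \<in> H m"
      by (auto simp: Hgen_def)
    then show "x \<in> Hsplit (m + 1)"
    proof cases
      case 1
      then have "T (m + 1) * x = x * T (m + 1)" using step by (intro H_commute) auto
      then show ?thesis using 1 by (auto simp: Hsplit_def intro: H_mono)
    next
      case 2
      then show ?thesis using step unfolding Hsplit_def by auto
    qed
  qed
  then have "span_sc (Hgen m) \<subseteq> span_sc (Hsplit (m + 1))"
    by (meson span_sc_left[where a = 1, simplified] span_sc_base subset_iff)
  then show ?case using step H_decomp_step[of "m + 1"] by auto
qed

section \<open>Products of a lattice monomial and a finite part\<close>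

definition YH :: "nat \<Rightarrow> 'a set" where
  "YH m = {Ymon 0 D * b | D b. length D = n \<and> b \<in> H m}"

lemma T_YH:
  assumes "1 \<le> i" "i < m" "m \<le> n" "s \<in> YH m"
  shows "T i * s \<in> span_sc (YH m)"
proof -
  obtain D b where s: "s = Ymon 0 D * b" "length D = n" "b \<in> H m" using assms by (auto simp: YH_def)
  define D1 D2 where "D1 = take (i - 1) D" and "D2 = drop (i + 1) D"
  define k d where "k = D ! (i - 1)" and "d = D ! i"
  have D: "D = D1 @ [k, d] @ D2"
    using assms s Cons_nth_drop_Suc[of "i - 1" D] Cons_nth_drop_Suc[of i D]
    by (simp add: D1_def D2_def k_def d_def)
  have len: "length (D1 @ [s, t] @ D2) = n" for s t using s(2) unfolding D by simp
  have i: "i = length D1 + 1" using assms s by (simp add: D1_def)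
  have base: "Ymon 0 (D1 @ [x, y] @ D2) * c \<in> span_sc (YH m)" if "c \<in> H m" for x y c
    using that len[of x y] unfolding YH_def by (intro span_sc_base) blast
  \<comment> \<open>The exponents are taken in swapped order, so that the original monomial appears
    directly to the right of \<open>Ti i\<close>.\<close>
  have ex: "Ymon 0 (D1 @ [d, k] @ D2) * Ti i = Ti i * Ymon 0 (D1 @ [k, d] @ D2)
      + h * exchange_sum (\<lambda>x y. Ymon 0 (D1 @ [x, y] @ D2)) d k"
    using len i by (intro Ymon_exchange) auto
  have Ti: "Ti i = T i - h" using assms by (intro Ti_eq) auto
  have "exchange_sum (\<lambda>x y. Ymon 0 (D1 @ [x, y] @ D2)) d k * b = exchange_sum (\<lambda>x y. Ymon 0 (D1 @ [x, y] @ D2) * b) d k"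
    by (rule exchange_sum_additive) (simp add: distrib_right)
  then have c: "exchange_sum (\<lambda>x y. Ymon 0 (D1 @ [x, y] @ D2)) d k * b \<in> span_sc (YH m)"
    using base s(3) by (auto intro!: span_sc_exchange_sum)
  have "T i * s = Ymon 0 (D1 @ [d, k] @ D2) * (T i * b) - h * (Ymon 0 (D1 @ [d, k] @ D2) * b)
      - h * (exchange_sum (\<lambda>x y. Ymon 0 (D1 @ [x, y] @ D2)) d k * b) + h * (Ymon 0 (D1 @ [k, d] @ D2) * b)"
  proof -
    have "T i * Ymon 0 D = Ymon 0 (D1 @ [d, k] @ D2) * T i - Ymon 0 (D1 @ [d, k] @ D2) * h
        - h * exchange_sum (\<lambda>x y. Ymon 0 (D1 @ [x, y] @ D2)) d k + h * Ymon 0 D"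
      using ex unfolding Ti D[symmetric] by (simp add: algebra_simps)
    then have "T i * Ymon 0 D * b = \<dots> * b" by simp
    then show ?thesis
      by (simp only: s(1) mult.assoc distrib_right left_diff_distrib h_central D[symmetric])
  qed
  also have "\<dots> \<in> span_sc (YH m)"
    using s(3) assms by (intro span_sc_add span_sc_diff span_sc_h base c H_mult H_T) auto
  finally show ?thesis .
qed

lemma H_YH: "b \<in> H m \<Longrightarrow> m \<le> n \<Longrightarrow> x \<in> span_sc (YH m) \<Longrightarrow> b * x \<in> span_sc (YH m)"
  unfolding H_def by (erule alg_preserve) (use T_YH in auto)

section \<open>Reducing classes in the cocenter to the standard ones\<close>

definition Std :: "'a set" where
  "Std = Estd ` {u. [] \<notin> set u \<and> length (concat u) = n}"

definition Good :: "'a set" where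
  "Good = {x. \<exists>y\<in>span_sc Std. x - y \<in> K}"

lemma Good_add: "x \<in> Good \<Longrightarrow> y \<in> Good \<Longrightarrow> x + y \<in> Good"
proof -
  assume "x \<in> Good" "y \<in> Good"
  then obtain x' y' where "x' \<in> span_sc Std" "y' \<in> span_sc Std" "x - x' \<in> K" "y - y' \<in> K" by (auto simp: Good_def)
  then show ?thesis using span_sc_add[of x' Std y'] K_add[of "x - x'" "y - y'"]
    by (auto simp: Good_def algebra_simps intro!: bexI[of _ "x' + y'"])
qed

lemma Good_sc: "x \<in> Good \<Longrightarrow> sc c * x \<in> Good"
proof -
  assume "x \<in> Good"
  then obtain y where "y \<in> span_sc Std" "x - y \<in> K" by (auto simp: Good_def)
  then show ?thesis using K_sc[of "x - y" c] span_sc_sc[of y Std c]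
    by (auto simp: Good_def right_diff_distrib)
qed

lemma Good_Std: "x \<in> Std \<Longrightarrow> x \<in> Good"
  unfolding Good_def using span_sc_base[of x Std] K_0 by (auto intro!: bexI[of _ x])

lemma Good_commute: "y * x \<in> Good \<Longrightarrow> x * y \<in> Good"
proof -
  assume "y * x \<in> Good"
  then obtain z where "z \<in> span_sc Std" "y * x - z \<in> K" by (auto simp: Good_def)
  then show ?thesis using K_add[OF K_commutator[of x y], of "y * x - z"] by (auto simp: Good_def)
qed

lemma Good_span_sc:
  assumes "x \<in> span_sc G" "\<And>g. g \<in> G \<Longrightarrow> a * g * b \<in> Good"
  shows "a * x * b \<in> Good"
  using assms(1)
proof induction
  case span_sc_zero
  then show ?case unfolding Good_def using span_sc.span_sc_zero[of Std] K_0 by (auto intro!: bexI[of _ 0])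
next
  case (span_sc_gen g c)
  then show ?case using Good_sc[OF assms(2), of g c] by (simp add: sc_left mult.assoc)
qed (simp_all add: distrib_left distrib_right Good_add)

definition TJ :: "(nat \<Rightarrow> bool) \<Rightarrow> nat \<Rightarrow> 'a" where
  "TJ J m = prod_list (map (\<lambda>i. if J i then T i else 1) [m..<n])"

text \<open>\<open>J\<close> holds at \<open>i\<close> exactly when strands \<open>i\<close> and
  \<open>i + 1\<close> share a block. Building from the last strand, the new exponent either joins
  the first block or opens a block of its own.\<close>

lemma TJ_eq_Tblocks:
  assumes "D \<noteq> []"
  shows "m + length D = n \<Longrightarrow> \<exists>u. concat u = D \<and> [] \<notin> set u \<and> u \<noteq> [] \<and> Tblocks m u = TJ J (m + 1)"
  using assms
proof (induction D arbitrary: m rule: list_nonempty_induct)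
  case (single d)
  then show ?case by (intro exI[of _ "[[d]]"]) (simp add: TJ_def)
next
  case (cons d D)
  then have "(m + 1) + length D = n" by simp
  from cons.IH[OF this] obtain u where u: "concat u = D" "[] \<notin> set u" "u \<noteq> []" "Tblocks (m + 1) u = TJ J (m + 2)"
    by auto
  have "m + 1 < n" using cons by (cases D) auto
  then have TJ: "TJ J (m + 1) = (if J (m + 1) then T (m + 1) else 1) * TJ J (m + 2)"
    by (simp add: TJ_def upt_conv_Cons)
  show ?case
  proof (cases "J (m + 1)")
    case True
    obtain e v where ev: "u = e # v" using u(3) by (cases u) auto
    have "e \<noteq> []" using u(2) ev by auto
    then have "Tup (m + 1) (m + length (d # e)) = T (m + 1) * Tup (m + 2) (m + 1 + length e)"
      using Tup_Suc[of "m + 1" "m + length (d # e)"] by simp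
    then have "Tblocks m ((d # e) # v) = T (m + 1) * Tblocks (m + 1) u" by (simp add: ev mult.assoc)
    then show ?thesis using u ev True TJ by (intro exI[of _ "(d # e) # v"]) auto
  next
    case False
    then show ?thesis using u TJ by (intro exI[of _ "[d] # u"]) auto
  qed
qed

text \<open>At \<open>m = n\<close> the product \<open>TJ J m\<close> is empty and \<open>b\<close>
  is any element of \<open>H n\<close>; at \<open>m = 1\<close> the element \<open>b\<close> is a
  scalar and only a standard class remains. Each descent step decides whether \<open>T m\<close> is
  recorded in \<open>J\<close>.\<close>

lemma descent: "1 \<le> m \<Longrightarrow> m \<le> n \<Longrightarrow> length D = n \<Longrightarrow> b \<in> H m \<Longrightarrow> Ymon 0 D * b * TJ J m \<in> Good"
proof (induction m arbitrary: D b J rule: dec_induct)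
  case base
  obtain c where c: "b = sc c" using base H_1_sc by auto
  have "D \<noteq> []" using base by auto
  then obtain u where u: "concat u = D" "[] \<notin> set u" "Tblocks 0 u = TJ J 1"
    using TJ_eq_Tblocks[of D 0 J] base by auto
  then have "Ymon 0 D * TJ J 1 \<in> Good"
    using base by (intro Good_Std) (auto simp: Std_def Estd_def intro!: image_eqI[of _ _ u])
  then show ?case using Good_sc[of "Ymon 0 D * TJ J 1" c] by (simp add: c sc_central mult.assoc)
next
  case (step m)
  have TJ: "TJ (J(m := v)) m = (if v then T m else 1) * TJ J (m + 1)" for v
  proof -
    have "map (\<lambda>i. if (J(m := v)) i then T i else 1) [m + 1..<n]
        = map (\<lambda>i. if J i then T i else 1) [m + 1..<n]" by (rule map_cong) auto
    moreover have "[m..<n] = m # [m + 1..<n]" using step.prems(1) by (simp add: upt_conv_Cons)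
    ultimately show ?thesis by (simp only: TJ_def list.map prod_list.Cons fun_upd_same)
  qed
  have "b \<in> span_sc (Hgen m)" using H_decomp[of m] step by auto
  moreover have "Ymon 0 D * g * TJ J (m + 1) \<in> Good" if "g \<in> Hgen m" for g
    using that[unfolded Hgen_def]
  proof
    assume "g \<in> H m"
    then have "Ymon 0 D * g * TJ (J(m := False)) m \<in> Good" using step by auto
    then show ?thesis by (simp add: TJ)
  next
    assume "g \<in> {a * T m * b | a b. a \<in> H m \<and> b \<in> H m}"
    then obtain a b where g: "g = a * T m * b" "a \<in> H m" "b \<in> H m" by auto
    \<comment> \<open>All indices in \<open>TJ J (m + 1)\<close> exceed \<open>m\<close>, so
      \<open>b\<close> can reach the right end and return cyclically to the front.\<close>
    have b: "b * TJ J (m + 1) = TJ J (m + 1) * b"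
      unfolding TJ_def by (rule commute_prod_list) (use g H_commute[of b m] in auto)
    have "Ymon 0 D * a \<in> YH m" using g step by (auto simp: YH_def)
    \<comment> \<open>Moved to the front, \<open>b\<close> is absorbed into combinations of
      monomials times elements of \<open>H m\<close>, to which the induction hypothesis applies with
      \<open>T m\<close> recorded in \<open>J\<close>.\<close>
    then have "b * (Ymon 0 D * a) \<in> span_sc (YH m)" using H_YH[OF g(3)] step span_sc_base by auto
    then have "1 * (b * (Ymon 0 D * a)) * TJ (J(m := True)) m \<in> Good"
      by (rule Good_span_sc) (use step in \<open>auto simp: YH_def\<close>)
    then have "b * (Ymon 0 D * a * T m * TJ J (m + 1)) \<in> Good" by (simp add: TJ mult.assoc)
    then have "(Ymon 0 D * a * T m * TJ J (m + 1)) * b \<in> Good" by (rule Good_commute)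
    moreover have "Ymon 0 D * g * TJ J (m + 1) = (Ymon 0 D * a * T m * TJ J (m + 1)) * b"
      by (simp only: g(1) b mult.assoc)
    ultimately show ?thesis by simp
  qed
  ultimately show ?case using Good_span_sc[of b "Hgen m" "Ymon 0 D" "TJ J (m + 1)"] by simp
qed

section \<open>Every word is a combination of elements of \<open>YH n\<close>\<close>

definition letters :: "'a set" where
  "letters = {Om, Omi} \<union> (if 2 \<le> n then T ` {..<n} \<union> Ti ` {..<n} else {})"

text \<open>The multipliers \<open>P\<close> that preserve the span are closed under products and
  contain \<open>T i\<close> and \<open>Ti i\<close> for positive \<open>i\<close> as well as
  \<open>Y 1\<close> and \<open>Yi 1\<close>. \<open>Om\<close> is \<open>Y 1\<close> times inverses
  of the \<open>T i\<close>, \<open>Omi\<close> is obtained likewise, and index 0 is reached by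
  conjugating index \<open>n - 1\<close> with \<open>Om\<close>.\<close>

lemma letters_YH:
  assumes "l \<in> letters" "x \<in> span_sc (YH n)" shows "l * x \<in> span_sc (YH n)"
proof -
  define P where "P = {y. \<forall>x\<in>span_sc (YH n). y * x \<in> span_sc (YH n)}"
  have mult: "y * z \<in> P" if "y \<in> P" "z \<in> P" for y z using that by (auto simp: P_def mult.assoc)
  have one: "1 \<in> P" by (simp add: P_def)
  have prod: "prod_list (map f ls) \<in> P" if "\<And>l. l \<in> set ls \<Longrightarrow> f l \<in> P" for f :: "nat \<Rightarrow> 'a" and ls
    using that by (induction ls) (auto intro: mult one)
  have T: "T i \<in> P" if "1 \<le> i" "i < n" for i
    using H_YH[OF H_T[OF that]] by (auto simp: P_def)
  have Ti: "Ti i \<in> P" if "1 \<le> i" "i < n" for i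
    using T[OF that] by (auto simp: P_def Ti_eq[OF that] left_diff_distrib intro: span_sc_diff span_sc_h)
  have Y: "Y 1 \<in> P \<and> Yi 1 \<in> P"
  proof -
    have 1: "1 * (Y 1 * s) \<in> span_sc (YH n) \<and> Yi 1 * s \<in> span_sc (YH n)" if s: "s \<in> YH n" for s
    proof -
      obtain D b where s: "s = Ymon 0 D * b" "length D = n" "b \<in> H n" using s by (auto simp: YH_def)
      then obtain d D' where D: "D = d # D'" using n_pos by (cases D) auto
      have "Y 1 * s = Ymon 0 ((d + 1) # D') * b" "Yi 1 * s = Ymon 0 ((d - 1) # D') * b"
        using Yp_Suc[of 1 d] Yp_pred[of 1 d] n_pos by (simp_all add: s D mult.assoc)
      moreover have "Ymon 0 (e # D') * b \<in> YH n" for e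
      proof -
        have "length (e # D') = n" using s D by simp
        then show ?thesis unfolding YH_def using s(3) by blast
      qed
      ultimately show ?thesis by (auto intro: span_sc_base)
    qed
    then show ?thesis unfolding P_def by (auto intro: span_sc_left)
  qed
  have Om: "Om \<in> P"
  proof -
    have "Y 1 * Tiup 1 n = Om * (Tdn 1 n * Tiup 1 n)" by (simp add: Y_def Tidn_def mult.assoc)
    then have "Om = Y 1 * Tiup 1 n" using Tdn_Tiup[of 1 n] by simp
    moreover have "Tiup 1 n \<in> P" unfolding Tiup_def by (rule prod) (use Ti in auto)
    ultimately show ?thesis using mult[of "Y 1" "Tiup 1 n"] Y by simp
  qed
  have Omi: "Omi \<in> P"
  proof -
    have "Tdn 1 n * Yi 1 = (Tdn 1 n * Tiup 1 n) * Omi" by (simp add: Yi_def mult.assoc)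
    then have "Omi = Tdn 1 n * Yi 1" using Tdn_Tiup[of 1 n] by simp
    moreover have "Tdn 1 n \<in> P" unfolding Tdn_def by (rule prod) (use T in auto)
    ultimately show ?thesis using mult[of "Tdn 1 n" "Yi 1"] Y by simp
  qed
  have T0: "T 0 \<in> P \<and> Ti 0 \<in> P" if n: "2 \<le> n"
  proof -
    have 1: "T 0 = Om * T (n - 1) * Omi" using Om_T_Omi[of "n - 1"] n by simp
    have "Om * T (n - 1) = T 0 * Om" using Om_T_last n by simp
    then have "Om * Ti (n - 1) = Ti 0 * Om"
      by (rule commute_inverse) (use T_Ti[of "n - 1"] Ti_T[of 0] n in auto)
    then have "Om * Ti (n - 1) * Omi = Ti 0 * (Om * Omi)" by (simp add: mult.assoc)
    then have 2: "Ti 0 = Om * Ti (n - 1) * Omi" using Om_Omi by simp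
    show ?thesis unfolding 1 2 using mult Om Omi T[of "n - 1"] Ti[of "n - 1"] n by auto
  qed
  have "l \<in> P"
  proof -
    have "T i \<in> P \<and> Ti i \<in> P" if "2 \<le> n" "i < n" for i
      using T0 T[of i] Ti[of i] that by (cases "i = 0") auto
    then show ?thesis using assms(1) Om Omi by (auto simp: letters_def split: if_splits)
  qed
  then show ?thesis using assms(2) by (auto simp: P_def)
qed

lemma Ymon_replicate_0: "Ymon m (replicate k 0) = 1"
  by (induction k arbitrary: m) auto

lemma word_Good: assumes "set ls \<subseteq> letters" shows "prod_list ls \<in> Good"
proof -
  have "prod_list ls \<in> span_sc (YH n)"
    using assms
  proof (induction ls)
    case Nil
    have "Ymon 0 (replicate n 0) * 1 \<in> YH n" unfolding YH_def using H_one by (force simp del: mult_1_right)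
    then show ?case using span_sc_base by (simp add: Ymon_replicate_0)
  next
    case (Cons l ls)
    then show ?case using letters_YH by auto
  qed
  moreover have "g \<in> Good" if "g \<in> YH n" for g
  proof -
    obtain D b where "g = Ymon 0 D * b" "length D = n" "b \<in> H n" using \<open>g \<in> YH n\<close> by (auto simp: YH_def)
    then show ?thesis using descent[of n D b "\<lambda>_. False"] n_pos by (simp add: TJ_def)
  qed
  ultimately show ?thesis using Good_span_sc[of "prod_list ls" "YH n" 1 1] by simp
qed

end

section \<open>The affine Hecke algebras as quotients\<close>

lemma lookup_smul: "Poly_Mapping.lookup (smul c p) k = c * Poly_Mapping.lookup p k"
proof -
  have "Poly_Mapping.lookup (smul c p) k
      = (\<Sum>b\<in>Poly_Mapping.keys p. if b = k then c * Poly_Mapping.lookup p b else 0)"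
    unfolding smul_def lookup_sum by (rule sum.cong) (auto simp: lookup_single when_def)
  then show ?thesis by (simp add: in_keys_iff)
qed

lemma smul_add: "smul c (p + r) = smul c p + smul c r"
  by (rule poly_mapping_eqI) (simp add: lookup_smul lookup_add distrib_left)

lemma smul_add_left: "smul (c + d) p = smul c p + smul d p"
  by (rule poly_mapping_eqI) (simp add: lookup_smul lookup_add distrib_right)

lemma smul_smul: "smul c (smul d p) = smul (c * d) p"
  by (rule poly_mapping_eqI) (simp add: lookup_smul mult.assoc)

lemma smul_1: "smul 1 p = p"
  by (rule poly_mapping_eqI) (simp add: lookup_smul)

lemma smul_0: "smul 0 p = 0"
  by (rule poly_mapping_eqI) (simp add: lookup_smul)

lemma smul_zero: "smul c 0 = 0"
  by (rule poly_mapping_eqI) (simp add: lookup_smul)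

lemma smul_minus_1: "smul (- 1) p = - p"
  by (rule poly_mapping_eqI) (simp add: lookup_smul)

lemma smul_diff: "smul c (p - r) = smul c p - smul c r"
  by (rule poly_mapping_eqI) (simp add: lookup_smul lookup_minus right_diff_distrib)

lemma smul_single: "smul c (Poly_Mapping.single b d) = Poly_Mapping.single b (c * d)"
  by (rule poly_mapping_eqI) (simp add: lookup_smul lookup_single when_def)

lemma lspan_zero: "0 \<in> lspan G"
  unfolding lspan_def by (auto intro!: exI[of _ "[]"])

lemma lspan_add: "x \<in> lspan G \<Longrightarrow> y \<in> lspan G \<Longrightarrow> x + y \<in> lspan G"
proof -
  assume "x \<in> lspan G" "y \<in> lspan G"
  then obtain xs ys where "set (map snd xs) \<subseteq> G" "x = (\<Sum>(c, v)\<leftarrow>xs. smul c v)"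
    "set (map snd ys) \<subseteq> G" "y = (\<Sum>(c, v)\<leftarrow>ys. smul c v)" unfolding lspan_def by blast
  then have "set (map snd (xs @ ys)) \<subseteq> G" "x + y = (\<Sum>(c, v)\<leftarrow>xs @ ys. smul c v)" by simp_all
  then show ?thesis unfolding lspan_def by blast
qed

lemma lspan_base: "v \<in> G \<Longrightarrow> v \<in> lspan G"
  unfolding lspan_def by (auto intro!: exI[of _ "[(1, v)]"] simp: smul_1)

lemma lspan_induct [consumes 1, case_names zero base add]:
  assumes "x \<in> lspan G" "P 0" "\<And>c v. v \<in> G \<Longrightarrow> P (smul c v)" "\<And>x y. P x \<Longrightarrow> P y \<Longrightarrow> P (x + y)"
  shows "P x"
proof -
  obtain xs where xs: "set (map snd xs) \<subseteq> G" "x = (\<Sum>(c, v)\<leftarrow>xs. smul c v)"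
    using assms(1) unfolding lspan_def by blast
  have "P (\<Sum>(c, v)\<leftarrow>xs. smul c v)" using xs(1) by (induction xs) (auto intro!: assms)
  then show ?thesis using xs by simp
qed

lemma lspan_smul: "x \<in> lspan G \<Longrightarrow> smul c x \<in> lspan G"
proof (induction rule: lspan_induct)
  case (base d v)
  have "smul c (smul d v) = (\<Sum>(c, v)\<leftarrow>[(c * d, v)]. smul c v)" by (simp add: smul_smul)
  then show ?case using base unfolding lspan_def by (intro CollectI exI[of _ "[(c * d, v)]"]) auto
qed (simp_all add: smul_zero lspan_zero smul_add lspan_add)

lemma lspan_uminus: "x \<in> lspan G \<Longrightarrow> - x \<in> lspan G"
  using lspan_smul[of x G "- 1"] by (simp add: smul_minus_1)

lemma lspan_diff: "x \<in> lspan G \<Longrightarrow> y \<in> lspan G \<Longrightarrow> x - y \<in> lspan G"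
  using lspan_add[of x G "- y"] lspan_uminus[of y G] by simp

lemma lspan_mono: "x \<in> lspan G \<Longrightarrow> G \<subseteq> G' \<Longrightarrow> x \<in> lspan G'"
  unfolding lspan_def by blast

text \<open>Linear extension from the basis; \<open>Psi\<close>, \<open>proj\<close>,
  \<open>wrap\<close> and multiplication by a single word are all instances.\<close>

definition lext :: "('b \<Rightarrow> 'c fm) \<Rightarrow> 'b fm \<Rightarrow> 'c fm" where
  "lext \<phi> p = (\<Sum>b\<in>Poly_Mapping.keys p. smul (Poly_Mapping.lookup p b) (\<phi> b))"

lemma lext_zero: "lext \<phi> 0 = 0" by (simp add: lext_def)

lemma lext_add: "lext \<phi> (p + r) = lext \<phi> p + lext \<phi> r"
  unfolding lext_def by (rule setsum_keys_plus_distrib) (simp_all add: smul_0 smul_add_left)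

lemma lext_single: "lext \<phi> (Poly_Mapping.single b c) = smul c (\<phi> b)"
  by (cases "c = 0") (simp_all add: lext_def smul_0)

lemma fm_induct [case_names zero single add]:
  assumes "P 0" "\<And>b c. P (Poly_Mapping.single b c)" "\<And>p r. P p \<Longrightarrow> P r \<Longrightarrow> P (p + r)"
  shows "P (p :: 'b fm)"
proof -
  have "p = (\<Sum>b\<in>Poly_Mapping.keys p. Poly_Mapping.single b (Poly_Mapping.lookup p b))"
    using smul_1[of p] by (simp add: smul_def)
  also have "P \<dots>"
  proof -
    have "P (\<Sum>b\<in>A. Poly_Mapping.single b (Poly_Mapping.lookup p b))" for A
      by (induction A rule: infinite_finite_induct) (auto intro!: assms)
    then show ?thesis .
  qed
  finally show ?thesis .
qed

lemma lext_smul: "lext \<phi> (smul c p) = smul c (lext \<phi> p)"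
  by (induction p rule: fm_induct)
    (simp_all add: smul_zero lext_zero lext_single smul_single smul_smul smul_add lext_add)

lemma lext_uminus: "lext \<phi> (- p) = - lext \<phi> p"
  using lext_smul[of \<phi> "- 1" p] by (simp add: smul_minus_1)

lemma lext_diff: "lext \<phi> (p - r) = lext \<phi> p - lext \<phi> r"
  using lext_add[of \<phi> p "- r"] by (simp add: lext_uminus)

lemma lext_sum: "lext \<phi> (sum f A) = (\<Sum>a\<in>A. lext \<phi> (f a))"
  by (induction A rule: infinite_finite_induct) (simp_all add: lext_zero lext_add)

lemma lext_lext: "lext \<phi> (lext \<psi> p) = lext (\<lambda>b. lext \<phi> (\<psi> b)) p"
  by (induction p rule: fm_induct) (simp_all add: lext_zero lext_single lext_smul lext_add)

lemma lin_Nil: "lin [] = 0" by (simp add: lin_def)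
lemma lin_Cons: "lin ((c, b) # xs) = Poly_Mapping.single b c + lin xs" by (simp add: lin_def)

text \<open>The wrapper makes words under concatenation an additive monoid, so that convolution on
  \<open>free_alg\<close> is the product of the free algebra.\<close>

datatype lword = LW (lw: "lett list")

instantiation lword :: monoid_add
begin
definition zero_lword :: lword where "0 = LW []"
definition plus_lword :: "lword \<Rightarrow> lword \<Rightarrow> lword" where "a + b = LW (lw a @ lw b)"
instance by standard (simp_all add: zero_lword_def plus_lword_def)
end

type_synonym free_alg = "lword \<Rightarrow>\<^sub>0 laur"

text \<open>Letters that do not exist in \<open>ABr_n\<close> are deleted; this makes the preimage of the relation ideal
  of \<open>AH_n\<close> a two-sided ideal of the free algebra on all letters.\<close>
definition proj :: "nat \<Rightarrow> free_alg \<Rightarrow> (nat \<times> lett list) fm" where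
  "proj n = lext (\<lambda>w. Poly_Mapping.single (n, filter (valid_lett n) (lw w)) 1)"

lemma proj_linear:
  "proj n 0 = 0" "proj n (x + y) = proj n x + proj n y"
  "proj n (x - y) = proj n x - proj n y" "proj n (- x) = - proj n x"
  by (simp_all add: proj_def lext_zero lext_add lext_diff lext_uminus)

lemma proj_single: "proj n (Poly_Mapping.single w c) = Poly_Mapping.single (n, filter (valid_lett n) (lw w)) c"
  by (simp add: proj_def lext_single smul_single)

definition wrap :: "lett list \<Rightarrow> lett list \<Rightarrow> (nat \<times> lett list) fm \<Rightarrow> (nat \<times> lett list) fm" where
  "wrap a b = lext (\<lambda>(n, w). Poly_Mapping.single (n, a @ w @ b) 1)"

lemma proj_wrap:
  "proj n (Poly_Mapping.single u c * x * Poly_Mapping.single v d)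
   = smul (c * d) (wrap (filter (valid_lett n) (lw u)) (filter (valid_lett n) (lw v)) (proj n x))"
proof (induction x rule: fm_induct)
  case (single b e)
  then show ?case
    by (simp add: mult_single proj_single wrap_def lext_single smul_single plus_lword_def mult.commute mult.left_commute mult.assoc)
qed (simp_all add: proj_linear wrap_def lext_zero lext_add smul_zero smul_add distrib_left distrib_right)

text \<open>The part of \<open>Ktr\<close> in rank \<open>n\<close> that comes from the relations
  alone; its preimage under \<open>proj n\<close> is the ideal to be divided out.\<close>

definition rel_ideal :: "nat \<Rightarrow> (nat \<times> lett list) fm set" where
  "rel_ideal n = lspan {at n a b r | a b r. valid_word n a \<and> valid_word n b \<and> r \<in> ah_rels n}"

lemma rel_ideal_subset_Ktr: "x \<in> rel_ideal n \<Longrightarrow> x \<in> Ktr"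
  unfolding rel_ideal_def Ktr_def by (erule lspan_mono) auto

lemma rel_ideal_closed:
  "0 \<in> rel_ideal n" "x \<in> rel_ideal n \<Longrightarrow> y \<in> rel_ideal n \<Longrightarrow> x + y \<in> rel_ideal n"
  "x \<in> rel_ideal n \<Longrightarrow> - x \<in> rel_ideal n" "x \<in> rel_ideal n \<Longrightarrow> y \<in> rel_ideal n \<Longrightarrow> x - y \<in> rel_ideal n"
  by (simp_all add: rel_ideal_def lspan_zero lspan_add lspan_uminus lspan_diff)

lemma Ktr_add: "x \<in> Ktr \<Longrightarrow> y \<in> Ktr \<Longrightarrow> x + y \<in> Ktr"
  unfolding Ktr_def by (rule lspan_add)

lemma Ktr_diff: "x \<in> Ktr \<Longrightarrow> y \<in> Ktr \<Longrightarrow> x - y \<in> Ktr"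
  unfolding Ktr_def by (rule lspan_diff)

lemma Ktr_smul: "x \<in> Ktr \<Longrightarrow> smul c x \<in> Ktr"
  unfolding Ktr_def by (rule lspan_smul)

lemma Ktr_zero: "0 \<in> Ktr"
  unfolding Ktr_def by (rule lspan_zero)

lemma wrap_lin: "wrap a b (lin (map (\<lambda>(c, w). (c, (n, w))) xs)) = lin (map (\<lambda>(c, w). (c, (n, a @ w @ b))) xs)"
  by (induction xs) (auto simp: wrap_def lin_Nil lin_Cons lext_zero lext_add lext_single smul_single)

lemma wrap_at: "wrap a b (at n u v r) = at n (a @ u) (v @ b) r"
  unfolding at_def
  using wrap_lin[of a b n "map (\<lambda>(c, w). (c, u @ w @ v)) r"]
  by (simp add: case_prod_unfold comp_def)

lemma valid_word_filter: "valid_word n (filter (valid_lett n) w)"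
  by (simp add: valid_word_def)

lemma valid_word_append: "valid_word n (a @ b) \<longleftrightarrow> valid_word n a \<and> valid_word n b"
  by (auto simp: valid_word_def)

lemma wrap_rel_ideal: "x \<in> rel_ideal n \<Longrightarrow> valid_word n a \<Longrightarrow> valid_word n b \<Longrightarrow> wrap a b x \<in> rel_ideal n"
  unfolding rel_ideal_def
proof (induction rule: lspan_induct)
  case zero
  then show ?case by (simp add: wrap_def lext_zero lspan_zero)
next
  case (base c v)
  then obtain u w r where v: "v = at n u w r" "valid_word n u" "valid_word n w" "r \<in> ah_rels n" by blast
  then have "wrap a b v = at n (a @ u) (w @ b) r" "valid_word n (a @ u)" "valid_word n (w @ b)"
    using base by (simp_all add: wrap_at valid_word_append)
  then have "wrap a b v \<in> {at n a b r | a b r. valid_word n a \<and> valid_word n b \<and> r \<in> ah_rels n}"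
    using v(4) by blast
  then have "smul c (wrap a b v) \<in> lspan {at n a b r | a b r. valid_word n a \<and> valid_word n b \<and> r \<in> ah_rels n}"
    by (intro lspan_smul lspan_base)
  then show ?case by (simp add: wrap_def lext_smul)
next
  case (add x y)
  then show ?case by (simp add: wrap_def lext_add lspan_add)
qed

lemma proj_ideal:
  assumes "proj n x \<in> rel_ideal n" shows "proj n (a * x) \<in> rel_ideal n" "proj n (x * b) \<in> rel_ideal n"
proof -
  have *: "proj n (Poly_Mapping.single u c * x * Poly_Mapping.single v d) \<in> rel_ideal n" for u c v d
    unfolding proj_wrap using wrap_rel_ideal[OF assms valid_word_filter valid_word_filter]
    unfolding rel_ideal_def by (rule lspan_smul)
  have one: "Poly_Mapping.single (LW []) 1 = (1 :: free_alg)"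
    using single_one[where 'a = lword and 'b = laur] by (simp add: zero_lword_def)
  show "proj n (a * x) \<in> rel_ideal n"
    using *[of _ _ "LW []" 1] unfolding one
    by (induction a rule: fm_induct) (simp_all add: proj_linear distrib_right rel_ideal_closed)
  show "proj n (x * b) \<in> rel_ideal n"
    using *[of "LW []" 1] unfolding one
    by (induction b rule: fm_induct) (simp_all add: proj_linear distrib_left rel_ideal_closed)
qed

lemma proj_commutator: "proj n (a * b - b * a) \<in> Ktr"
proof (induction a rule: fm_induct)
  case (single u c)
  show ?case
  proof (induction b rule: fm_induct)
    case (single v d)
    let ?u = "filter (valid_lett n) (lw u)" and ?v = "filter (valid_lett n) (lw v)"
    have "lin [(1, (n, ?u @ ?v)), (- 1, (n, ?v @ ?u))] \<in> Ktr"
      unfolding Ktr_def by (rule lspan_base) (use valid_word_filter in blast)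
    from Ktr_smul[OF this, of "c * d"] show ?case
      by (simp add: mult_single proj_linear proj_single plus_lword_def lin_Nil lin_Cons smul_diff smul_single
          single_uminus mult.commute)
  next
    case (add p r)
    from Ktr_add[OF add] show ?case by (simp add: proj_linear algebra_simps)
  qed (simp add: proj_linear Ktr_zero)
next
  case (add p r)
  from Ktr_add[OF add] show ?case by (simp add: proj_linear algebra_simps)
qed (simp add: proj_linear Ktr_zero)

text \<open>One type has to serve all \<open>AH_n\<close>, since the rank cannot be a type parameter: an element is a
  family of representatives, one for each rank. A word of \<open>AH_N\<close> is completed in the other ranks by
  its value under the character \<open>T_i \<mapsto> q\<close>, \<open>\<Omega> \<mapsto> 1\<close>, so that the relations of \<open>AH_N\<close> hold with the
  unit of the whole ring.\<close>
quotient_type ah_family = "nat \<Rightarrow> free_alg" / "\<lambda>f g. \<forall>n. proj n (f n - g n) \<in> rel_ideal n"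
proof (rule equivpI)
  show "reflp (\<lambda>f g. \<forall>n. proj n (f n - g n :: free_alg) \<in> rel_ideal n)"
    by (simp add: reflp_def proj_linear rel_ideal_closed)
  show "symp (\<lambda>f g. \<forall>n. proj n (f n - g n :: free_alg) \<in> rel_ideal n)"
  proof (rule sympI, rule allI)
    fix f g :: "nat \<Rightarrow> free_alg" and n
    assume "\<forall>n. proj n (f n - g n) \<in> rel_ideal n"
    then have "- proj n (f n - g n) \<in> rel_ideal n" using rel_ideal_closed by blast
    then show "proj n (g n - f n) \<in> rel_ideal n" by (simp add: proj_linear)
  qed
  show "transp (\<lambda>f g. \<forall>n. proj n (f n - g n :: free_alg) \<in> rel_ideal n)"
  proof (rule transpI, rule allI)
    fix f g k :: "nat \<Rightarrow> free_alg" and n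
    assume "\<forall>n. proj n (f n - g n) \<in> rel_ideal n" "\<forall>n. proj n (g n - k n) \<in> rel_ideal n"
    then have "proj n (f n - g n) + proj n (g n - k n) \<in> rel_ideal n" using rel_ideal_closed by blast
    then show "proj n (f n - k n) \<in> rel_ideal n" by (simp add: proj_linear)
  qed
qed

text \<open>Not \<open>ring_1\<close>: that class would in addition demand \<open>0 \<noteq> 1\<close>.\<close>
instantiation ah_family :: "{ring, monoid_mult}"
begin

lift_definition zero_ah_family :: ah_family is "\<lambda>_. 0" .
lift_definition one_ah_family :: ah_family is "\<lambda>_. 1" .

lift_definition plus_ah_family :: "ah_family \<Rightarrow> ah_family \<Rightarrow> ah_family" is "\<lambda>f g n. f n + g n"
proof -
  fix f f' g g' :: "nat \<Rightarrow> free_alg" and n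
  assume "\<And>n. proj n (f n - f' n) \<in> rel_ideal n" "\<And>n. proj n (g n - g' n) \<in> rel_ideal n"
  then have "proj n (f n - f' n) + proj n (g n - g' n) \<in> rel_ideal n" using rel_ideal_closed by blast
  then show "proj n (f n + g n - (f' n + g' n)) \<in> rel_ideal n" by (simp add: proj_linear algebra_simps)
qed

lift_definition minus_ah_family :: "ah_family \<Rightarrow> ah_family \<Rightarrow> ah_family" is "\<lambda>f g n. f n - g n"
proof -
  fix f f' g g' :: "nat \<Rightarrow> free_alg" and n
  assume "\<And>n. proj n (f n - f' n) \<in> rel_ideal n" "\<And>n. proj n (g n - g' n) \<in> rel_ideal n"
  then have "proj n (f n - f' n) - proj n (g n - g' n) \<in> rel_ideal n" using rel_ideal_closed by blast
  then show "proj n (f n - g n - (f' n - g' n)) \<in> rel_ideal n" by (simp add: proj_linear algebra_simps)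
qed

lift_definition uminus_ah_family :: "ah_family \<Rightarrow> ah_family" is "\<lambda>f n. - f n"
proof -
  fix f f' :: "nat \<Rightarrow> free_alg" and n
  assume "\<And>n. proj n (f n - f' n) \<in> rel_ideal n"
  then have "- proj n (f n - f' n) \<in> rel_ideal n" using rel_ideal_closed by blast
  then show "proj n (- f n - (- f' n)) \<in> rel_ideal n" by (simp add: proj_linear)
qed

lift_definition times_ah_family :: "ah_family \<Rightarrow> ah_family \<Rightarrow> ah_family" is "\<lambda>f g n. f n * g n"
proof -
  fix f f' g g' :: "nat \<Rightarrow> free_alg" and n
  assume 1: "\<And>n. proj n (f n - f' n) \<in> rel_ideal n" and 2: "\<And>n. proj n (g n - g' n) \<in> rel_ideal n"
  have "proj n ((f n - f' n) * g n) + proj n (f' n * (g n - g' n)) \<in> rel_ideal n"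
    by (rule rel_ideal_closed(2)[OF proj_ideal(2)[OF 1] proj_ideal(1)[OF 2]])
  then show "proj n (f n * g n - f' n * g' n) \<in> rel_ideal n"
    by (simp add: proj_linear algebra_simps)
qed

instance
proof
  fix a b c :: ah_family
  show "a + b + c = a + (b + c)" by transfer (simp add: proj_linear rel_ideal_closed add.assoc)
  show "a + b = b + a" by transfer (simp add: proj_linear rel_ideal_closed add.commute)
  show "0 + a = a" by transfer (simp add: proj_linear rel_ideal_closed)
  show "- a + a = 0" by transfer (simp add: proj_linear rel_ideal_closed)
  show "a - b = a + - b" by transfer (simp add: proj_linear rel_ideal_closed)
  show "a * b * c = a * (b * c)" by transfer (simp add: proj_linear rel_ideal_closed mult.assoc)
  show "(a + b) * c = a * c + b * c" by transfer (simp add: proj_linear rel_ideal_closed distrib_right)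
  show "a * (b + c) = a * b + a * c" by transfer (simp add: proj_linear rel_ideal_closed distrib_left)
  show "1 * a = a" by transfer (simp add: proj_linear rel_ideal_closed)
  show "a * 1 = a" by transfer (simp add: proj_linear rel_ideal_closed)
qed

end

text \<open>Otherwise lifting would also unfold the coefficients \<^typ>\<open>laur\<close> to functions.\<close>
lifting_forget poly_mapping.lifting

section \<open>Scalars, words and the trace in the quotient ring\<close>

lift_definition scalar :: "laur \<Rightarrow> ah_family" is "\<lambda>c _. Poly_Mapping.single 0 c" .

fun triv_char :: "lett \<Rightarrow> laur" where
  "triv_char (S i) = qp 1" | "triv_char (Si i) = qp (- 1)" | "triv_char W = 1" | "triv_char Wi = 1"

definition triv_char_word :: "lett list \<Rightarrow> laur" where "triv_char_word w = prod_list (map triv_char w)"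

lift_definition hword :: "nat \<Rightarrow> lett list \<Rightarrow> ah_family" is
  "\<lambda>N w m. if m = N then Poly_Mapping.single (LW w) 1 else Poly_Mapping.single 0 (triv_char_word w)" .

text \<open>Only the component of rank \<open>N\<close> is tested. This respects the quotient
  because \<open>Ktr\<close> contains \<open>rel_ideal N\<close>.\<close>

lift_definition trace_null :: "nat \<Rightarrow> ah_family \<Rightarrow> bool" is "\<lambda>N f. proj N (f N) \<in> Ktr"
proof -
  fix N :: nat and f g :: "nat \<Rightarrow> free_alg"
  assume a: "\<And>n. proj n (f n - g n) \<in> rel_ideal n"
  have "proj N (f N) - proj N (g N) \<in> Ktr"
    using rel_ideal_subset_Ktr[OF a[of N]] by (simp add: proj_linear)
  then show "(proj N (f N) \<in> Ktr) = (proj N (g N) \<in> Ktr)"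
    using Ktr_add[of "proj N (f N) - proj N (g N)" "proj N (g N)"]
      Ktr_diff[of "proj N (f N)" "proj N (f N) - proj N (g N)"] by auto
qed

lemma scalar_1: "scalar 1 = 1" by transfer (simp add: proj_linear rel_ideal_closed)
lemma scalar_add: "scalar (c + d) = scalar c + scalar d" by transfer (simp add: single_add proj_linear rel_ideal_closed)
lemma scalar_mult: "scalar (c * d) = scalar c * scalar d" by transfer (simp add: mult_single proj_linear rel_ideal_closed)

lemma single_0_central: "x * Poly_Mapping.single 0 c = Poly_Mapping.single 0 c * (x :: free_alg)"
  by (induction x rule: fm_induct) (simp_all add: mult_single distrib_left distrib_right mult.commute)

lemma scalar_central: "x * scalar c = scalar c * x"
  by transfer (simp add: single_0_central proj_linear rel_ideal_closed)

lemma LW_Nil: "LW [] = 0" by (simp add: zero_lword_def)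

lemma LW_append: "LW (u @ v) = LW u + LW v" by (simp add: plus_lword_def)

lemma hword_Nil: "hword N [] = 1"
  by transfer (auto simp: LW_Nil triv_char_word_def proj_linear rel_ideal_closed)

lemma hword_append: "hword N (u @ v) = hword N u * hword N v"
  by transfer (auto simp: mult_single LW_append[symmetric] triv_char_word_def proj_linear rel_ideal_closed)

lemma hword_Cons: "v \<noteq> [] \<Longrightarrow> hword N (l # v) = hword N [l] * hword N v"
  using hword_append[of N "[l]" v] by simp

lemma hword_map: "hword N (map f xs) = prod_list (map (\<lambda>i. hword N [f i]) xs)"
proof (induction xs)
  case (Cons x xs)
  then show ?case using hword_append[of N "[f x]" "map f xs"] by simp
qed (simp add: hword_Nil)

lemma hword_letters: "hword N w = prod_list (map (\<lambda>l. hword N [l]) w)"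
  using hword_map[of N "\<lambda>l. l" w] by simp

lift_definition hcomb :: "nat \<Rightarrow> (laur \<times> lett list) list \<Rightarrow> ah_family" is
  "\<lambda>N r m. if m = N then \<Sum>(c, w)\<leftarrow>r. Poly_Mapping.single (LW w) c
     else Poly_Mapping.single 0 (\<Sum>(c, w)\<leftarrow>r. c * triv_char_word w)" .

lemma hcomb_Nil: "hcomb N [] = 0"
  by transfer (simp add: proj_linear rel_ideal_closed)

lemma hcomb_Cons: "hcomb N ((c, w) # r) = scalar c * hword N w + hcomb N r"
  by transfer (auto simp: mult_single single_add proj_linear rel_ideal_closed)

lemma qp_mult: "qp a * qp b = qp (a + b)" by (simp add: qp_def mult_single)
lemma qp_0: "qp 0 = 1" by (simp add: qp_def)

lemma ah_rels_valid: "r \<in> ah_rels N \<Longrightarrow> (c, w) \<in> set r \<Longrightarrow> valid_word N w"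
  by (auto simp: ah_rels_def valid_word_def valid_lett_def split: if_splits)

text \<open>The value q is a root of the Hecke relation, and in the other relations both sides have
  the same value.\<close>

lemma ah_rels_triv_char: "r \<in> ah_rels N \<Longrightarrow> (\<Sum>(c, w)\<leftarrow>r. c * triv_char_word w) = 0"
  by (auto simp: ah_rels_def triv_char_word_def algebra_simps qp_mult qp_0 split: if_splits)

lemma proj_sum_list: "(\<And>c w. (c, w) \<in> set r \<Longrightarrow> valid_word N w) \<Longrightarrow>
  proj N (\<Sum>(c, w)\<leftarrow>r. Poly_Mapping.single (LW w) c) = at N [] [] r"
proof (induction r)
  case (Cons x r)
  obtain c w where x: "x = (c, w)" by (cases x)
  then have "valid_word N w" using Cons.prems[of c w] by simp
  then have "filter (valid_lett N) w = w" by (simp add: valid_word_def)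
  then show ?case using Cons by (auto simp: x proj_linear proj_single at_def lin_Cons)
qed (simp add: at_def lin_Nil proj_linear)

text \<open>In rank \<open>N\<close> the relation lies in the ideal; in every other rank its
  component is the scalar that the character assigns to it, which is 0.\<close>

lemma hcomb_ah_rels: assumes "r \<in> ah_rels N" shows "hcomb N r = 0"
proof -
  have "at N [] [] r \<in> rel_ideal N"
  proof -
    have "valid_word N []" by (simp add: valid_word_def)
    then show ?thesis unfolding rel_ideal_def using assms by (intro lspan_base) blast
  qed
  then have "proj N (\<Sum>(c, w)\<leftarrow>r. Poly_Mapping.single (LW w) c) \<in> rel_ideal N"
    using proj_sum_list[of r N] ah_rels_valid[OF assms] by simp
  with ah_rels_triv_char[OF assms] show ?thesis
    by transfer (auto simp: proj_linear rel_ideal_closed)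
qed

lemma trace_null_0: "trace_null N 0" by transfer (simp add: proj_linear Ktr_zero)
lemma trace_null_add: "trace_null N x \<Longrightarrow> trace_null N y \<Longrightarrow> trace_null N (x + y)" by transfer (simp add: proj_linear Ktr_add)
lemma trace_null_commutator: "trace_null N (x * y - y * x)" by transfer (rule proj_commutator)

lemma proj_smul: "proj n (Poly_Mapping.single 0 c * x) = smul c (proj n x)"
proof -
  have "Poly_Mapping.single 0 c * x = smul c x"
    by (induction x rule: fm_induct)
      (simp_all add: mult_single smul_single smul_zero smul_add distrib_left)
  then show ?thesis by (simp add: proj_def lext_smul)
qed

lemma trace_null_scalar: "trace_null N x \<Longrightarrow> trace_null N (scalar c * x)"
  by transfer (simp add: proj_smul Ktr_smul)

definition q_minus_qinv :: laur where "q_minus_qinv = qp 1 - qp (- 1)"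

lemma scalar_diff: "scalar (c - d) = scalar c - scalar d"
  using scalar_add[of "c - d" d] by simp

lemma scalar_minus_1: "scalar (- 1) = - 1"
  using scalar_diff[of 0 1] scalar_add[of 0 0] by (simp add: scalar_1)

lemma ah_rels_Om: "1 \<le> N \<Longrightarrow> [(1, [W, Wi]), (- 1, [])] \<in> ah_rels N"
  "1 \<le> N \<Longrightarrow> [(1, [Wi, W]), (- 1, [])] \<in> ah_rels N"
  by (auto simp: ah_rels_def)

lemma ah_rels_T:
  assumes "2 \<le> N" "i < N"
  shows "[(1, [S i, Si i]), (- 1, [])] \<in> ah_rels N" "[(1, [Si i, S i]), (- 1, [])] \<in> ah_rels N"
    "[(1, [W, S i, Wi]), (- 1, [S ((i + 1) mod N)])] \<in> ah_rels N"
    "[(1, [S i, S i]), (qp (- 1) - qp 1, [S i]), (- 1, [])] \<in> ah_rels N"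
  using assms by (auto simp: ah_rels_def)

lemma ah_rels_braid:
  assumes "3 \<le> N" "i < N"
  shows "[(1, [S i, S ((i + 1) mod N), S i]), (- 1, [S ((i + 1) mod N), S i, S ((i + 1) mod N)])] \<in> ah_rels N"
  using assms by (auto simp: ah_rels_def)

lemma ah_rels_far:
  assumes "3 \<le> N" "i < N" "j < N" "(i + N - j) mod N \<notin> {0, 1, N - 1}"
  shows "[(1, [S i, S j]), (- 1, [S j, S i])] \<in> ah_rels N"
proof -
  have "[(1, [S i, S j]), (- 1, [S j, S i])] \<in> {[(1, [S i, S j]), (- 1, [S j, S i])] | i j.
             i < N \<and> j < N \<and> (i + N - j) mod N \<notin> {0, 1, N - 1}}" using assms by blast
  then show ?thesis unfolding ah_rels_def using assms(1) by simp
qed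

lemma affine_hecke_algebra_ah_family:
  assumes N: "1 \<le> N"
  shows "affine_hecke_algebra N (\<lambda>i. hword N [S i]) (\<lambda>i. hword N [Si i]) (hword N [W]) (hword N [Wi])
    (scalar q_minus_qinv) {x. trace_null N x} scalar q_minus_qinv"
proof -
  note ex = hcomb_Nil hcomb_Cons scalar_1 scalar_minus_1 hword_Cons hword_Nil
  show ?thesis
  proof (unfold_locales, goal_cases)
    case 2 show ?case using hcomb_ah_rels[OF ah_rels_Om(1)[OF N]] by (simp add: ex)
  next
    case 3 show ?case using hcomb_ah_rels[OF ah_rels_Om(2)[OF N]] by (simp add: ex)
  next
    case (4 i) then show ?case using hcomb_ah_rels[OF ah_rels_T(1), of N i] by (simp add: ex)
  next
    case (5 i) then show ?case using hcomb_ah_rels[OF ah_rels_T(2), of N i] by (simp add: ex)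
  next
    case (6 i) then show ?case using hcomb_ah_rels[OF ah_rels_T(3), of N i] by (simp add: ex mult.assoc)
  next
    case (7 i) then show ?case using hcomb_ah_rels[OF ah_rels_T(4), of N i]
      by (simp add: ex scalar_diff q_minus_qinv_def left_diff_distrib algebra_simps)
  next
    case (8 i) then show ?case using hcomb_ah_rels[OF ah_rels_braid, of N i] by (simp add: ex mult.assoc)
  next
    case (9 i j) then show ?case using hcomb_ah_rels[OF ah_rels_far, of N i j] by (simp add: ex)
  qed (use N in \<open>auto intro: scalar_central trace_null_0 trace_null_add trace_null_commutator scalar_1 scalar_add scalar_mult trace_null_scalar\<close>)
qed

section \<open>Images of the generators\<close>

text \<open>The bridge from the quotient ring to the target: \<open>X\<close> is the rank
  \<open>N\<close> component of some representative of \<open>x\<close>. It is determined only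
  modulo \<open>rel_ideal N\<close>, which is enough to decide membership in
  \<open>Ktr\<close>.\<close>

definition realizes :: "nat \<Rightarrow> ah_family \<Rightarrow> (nat \<times> lett list) fm \<Rightarrow> bool" where
  "realizes N x X \<longleftrightarrow> (\<exists>f. x = abs_ah_family f \<and> proj N (f N) = X)"

lemma realizes_trace_null: "realizes N x X \<Longrightarrow> trace_null N x \<longleftrightarrow> X \<in> Ktr"
  by (auto simp: realizes_def trace_null.abs_eq)

lemma realizes_0: "realizes N 0 0"
  unfolding realizes_def by (intro exI[of _ "\<lambda>_. 0"]) (simp add: zero_ah_family.abs_eq proj_linear)

lemma realizes_add: "realizes N x X \<Longrightarrow> realizes N y Z \<Longrightarrow> realizes N (x + y) (X + Z)"
  unfolding realizes_def by (force simp: plus_ah_family.abs_eq proj_linear)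

lemma realizes_diff: "realizes N x X \<Longrightarrow> realizes N y Z \<Longrightarrow> realizes N (x - y) (X - Z)"
  unfolding realizes_def by (force simp: minus_ah_family.abs_eq proj_linear)

lemma realizes_uminus: "realizes N x X \<Longrightarrow> realizes N (- x) (- X)"
  using realizes_diff[OF realizes_0] by fastforce

lemma realizes_scalar: "realizes N x X \<Longrightarrow> realizes N (scalar c * x) (smul c X)"
  unfolding realizes_def by (force simp: scalar.abs_eq times_ah_family.abs_eq proj_smul)

lemma realizes_hword: "valid_word N w \<Longrightarrow> realizes N (hword N w) (Poly_Mapping.single (N, w) 1)"
  unfolding realizes_def
  by (intro exI[of _ "\<lambda>m. if m = N then Poly_Mapping.single (LW w) 1 else Poly_Mapping.single 0 (triv_char_word w)"])
     (simp add: hword.abs_eq proj_single valid_word_def)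

lemma realizes_sum: "(\<And>i. i \<in> A \<Longrightarrow> realizes N (f i) (g i)) \<Longrightarrow> realizes N (sum f A) (sum g A)"
  by (induction A rule: infinite_finite_induct) (auto intro: realizes_0 realizes_add)

lemma realizes_exchange_sum:
  "(\<And>i j. realizes N (f i j) (g i j)) \<Longrightarrow> realizes N (exchange_sum f k d) (exchange_sum g k d)"
  by (auto simp: exchange_sum_def intro!: realizes_sum realizes_uminus)

section \<open>Words for the products of generators\<close>

fun Ymon_word :: "nat \<Rightarrow> nat \<Rightarrow> int list \<Rightarrow> lett list" where
  "Ymon_word N m [] = []"
| "Ymon_word N m (d # ds) = Ypow N (m + 1) d @ Ymon_word N (m + 1) ds"

text \<open>Lattice letters and \<open>S\<close> letters alternate block by block, as the skein
  product concatenates them; \<open>hword_blocks_word\<close> sorts them inside the algebra.\<close>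

fun blocks_word :: "nat \<Rightarrow> nat \<Rightarrow> int list list \<Rightarrow> lett list" where
  "blocks_word N m [] = []"
| "blocks_word N m (ds # u) = Ymon_word N m ds @ map S [m + 1..<m + length ds] @ blocks_word N (m + length ds) u"

lemma Ymon_word_eq: "concat (map (\<lambda>i. Ypow N (m + i + 1) (ds ! i)) [0..<length ds]) = Ymon_word N m ds"
proof (induction ds arbitrary: m)
  case (Cons d ds)
  have "[0..<length (d # ds)] = 0 # map Suc [0..<length ds]" by (simp add: upt_conv_Cons map_Suc_upt del: upt_Suc)
  then show ?case using Cons[of "m + 1"] by (simp add: comp_def del: upt_Suc)
qed simp

lemma Ew_eq: "Ew ds = blocks_word (length ds) 0 [ds]"
  using Ymon_word_eq[of "length ds" 0 ds] by (simp add: Ew_def Let_def)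

section \<open>The two embeddings of the skein product on words\<close>

definition phi1_word :: "nat \<Rightarrow> nat \<Rightarrow> lett list \<Rightarrow> lett list" where "phi1_word n k w = concat (map (phi1 n k) w)"
definition phi2_word :: "nat \<Rightarrow> nat \<Rightarrow> lett list \<Rightarrow> lett list" where "phi2_word n k w = concat (map (phi2 n k) w)"

lemma phi1_word_append: "phi1_word n k (a @ b) = phi1_word n k a @ phi1_word n k b" by (simp add: phi1_word_def)
lemma phi2_word_append: "phi2_word n k (a @ b) = phi2_word n k a @ phi2_word n k b" by (simp add: phi2_word_def)

lemma phi1_word_replicate: "phi1_word n k (concat (replicate j w)) = concat (replicate j (phi1_word n k w))"
  by (induction j) (simp_all add: phi1_word_append, simp add: phi1_word_def)
lemma phi2_word_replicate: "phi2_word n k (concat (replicate j w)) = concat (replicate j (phi2_word n k w))"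
  by (induction j) (simp_all add: phi2_word_append, simp add: phi2_word_def)

text \<open>The special case \<open>k = 0\<close> of \<open>phi1\<close> fits the same formula,
  since the additional list is then empty.\<close>

lemma phi1_word_W: "phi1_word n k [W] = [W] @ map S (rev [n..<n + k])"
  and phi1_word_Wi: "phi1_word n k [Wi] = map Si [n..<n + k] @ [Wi]"
  by (simp_all add: phi1_word_def phi1_def Let_def)

lemma phi2_word_W: "phi2_word n k [W] = map Si (rev [1..<n + 1]) @ [W]"
  and phi2_word_Wi: "phi2_word n k [Wi] = [Wi] @ map S [1..<n + 1]"
  by (simp_all add: phi2_word_def phi2_def Let_def)

lemma phi1_word_S: "0 \<notin> set xs \<Longrightarrow> phi1_word n k (map S xs) = map S xs"
  and phi1_word_Si: "0 \<notin> set xs \<Longrightarrow> phi1_word n k (map Si xs) = map Si xs"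
  by (induction xs) (auto simp: phi1_word_def phi1_def Let_def)

lemma phi2_word_S: "0 \<notin> set xs \<Longrightarrow> phi2_word n k (map S xs) = map S (map (\<lambda>j. j + n) xs)"
  and phi2_word_Si: "0 \<notin> set xs \<Longrightarrow> phi2_word n k (map Si xs) = map Si (map (\<lambda>j. j + n) xs)"
  by (induction xs) (auto simp: phi2_word_def phi2_def Let_def)

lemma upt_split: "i \<le> j \<Longrightarrow> j \<le> k \<Longrightarrow> [i..<k] = [i..<j] @ [j..<k]"
  by (metis le_add_diff_inverse upt_add_eq_append)

text \<open>An equality of words: the letters that \<open>phi1\<close> puts behind \<open>W\<close>
  prolong the descending run of \<open>Yw n i\<close> up to rank \<open>n + k\<close>.\<close>

lemma phi1_word_Ypow:
  assumes "1 \<le> i" "i \<le> n" shows "phi1_word n k (Ypow n i d) = Ypow (n + k) i d"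
proof -
  have "phi1_word n k (Yw n i) = Yw (n + k) i"
    using assms upt_split[of i n "n + k"]
    unfolding Yw_def phi1_word_append phi1_word_W by (subst phi1_word_S phi1_word_Si, simp)+ simp
  moreover have "phi1_word n k (Yiw n i) = Yiw (n + k) i"
    using assms upt_split[of i n "n + k"]
    unfolding Yiw_def phi1_word_append phi1_word_Wi by (subst phi1_word_S phi1_word_Si, simp)+ simp
  ultimately show ?thesis by (simp add: Ypow_def phi1_word_replicate)
qed

lemma map_add_upt': "map (\<lambda>j. j + n) [i..<k] = [i + n..<k + n]"
  by (rule nth_equalityI) auto

text \<open>Here the inverses that \<open>phi2\<close> puts before \<open>W\<close> complete the
  shifted initial run down to index 1.\<close>

lemma phi2_word_Ypow:
  assumes "1 \<le> i" "i \<le> k" shows "phi2_word n k (Ypow k i d) = Ypow (n + k) (n + i) d"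
proof -
  have "phi2_word n k (Yw k i) = Yw (n + k) (n + i)"
    using assms upt_split[of 1 "n + 1" "n + i"]
    unfolding Yw_def phi2_word_append phi2_word_W
    by (subst phi2_word_S phi2_word_Si, simp)+ (simp add: rev_map[symmetric] map_add_upt' add.commute)
  moreover have "phi2_word n k (Yiw k i) = Yiw (n + k) (n + i)"
    using assms upt_split[of 1 "n + 1" "n + i"]
    unfolding Yiw_def phi2_word_append phi2_word_Wi
    by (subst phi2_word_S phi2_word_Si, simp)+ (simp add: map_add_upt' add.commute)
  ultimately show ?thesis by (simp add: Ypow_def phi2_word_replicate)
qed

lemma phi1_word_Ymon_word: "m + length ds \<le> n \<Longrightarrow> phi1_word n k (Ymon_word n m ds) = Ymon_word (n + k) m ds"
proof (induction ds arbitrary: m)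
  case Nil
  then show ?case by (simp add: phi1_word_def)
next
  case (Cons d ds)
  then show ?case using phi1_word_Ypow[of "m + 1" n k d] Cons.IH[of "m + 1"] by (simp add: phi1_word_append)
qed

lemma phi2_word_Ymon_word: "m + length ds \<le> k \<Longrightarrow> phi2_word n k (Ymon_word k m ds) = Ymon_word (n + k) (n + m) ds"
proof (induction ds arbitrary: m)
  case Nil
  then show ?case by (simp add: phi2_word_def)
next
  case (Cons d ds)
  then show ?case using phi2_word_Ypow[of "m + 1" k n d] Cons.IH[of "m + 1"] by (simp add: phi2_word_append)
qed

lemma phi2_word_blocks_word: "m + length (concat u) \<le> k \<Longrightarrow> phi2_word n k (blocks_word k m u) = blocks_word (n + k) (n + m) u"
proof (induction u arbitrary: m)
  case Nil
  then show ?case by (simp add: phi2_word_def)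
next
  case (Cons ds u)
  have "phi2_word n k (map S [m + 1..<m + length ds]) = map S [n + m + 1..<n + m + length ds]"
    using phi2_word_S[of "[m + 1..<m + length ds]" n k] by (simp only: map_add_upt') (simp add: ac_simps)
  then show ?case using Cons phi2_word_Ymon_word[of m ds k n] by (simp add: phi2_word_append add.assoc)
qed

text \<open>The number of blocks minus the number of strands, the total power of q collected from
  the generators.\<close>

definition qexp :: "int list list \<Rightarrow> int" where "qexp u = (\<Sum>ds\<leftarrow>u. 1 - int (length ds))"

lemma skein_single: "skein (Poly_Mapping.single a c) (Poly_Mapping.single b d) = Poly_Mapping.single (sk a b) (c * d)"
  by (simp add: skein_def conv_def)

lemma PsiW_eq: "PsiW u = Poly_Mapping.single (length (concat u), blocks_word (length (concat u)) 0 u) (qp (qexp u))"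
proof (induction u)
  case Nil
  then show ?case by (simp add: PsiW_def qexp_def qp_0)
next
  case (Cons ds u)
  let ?n = "length ds" and ?k = "length (concat u)"
  have "PsiW (ds # u) = skein (gimg ds) (PsiW u)" by (simp add: PsiW_def)
  also have "\<dots> = Poly_Mapping.single (sk (?n, Ew ds) (?k, blocks_word ?k 0 u)) (qp (1 - int ?n) * qp (qexp u))"
    unfolding Cons gimg_def skein_single ..
  also have "sk (?n, Ew ds) (?k, blocks_word ?k 0 u) = (?n + ?k, phi1_word ?n ?k (Ew ds) @ phi2_word ?n ?k (blocks_word ?k 0 u))"
    by (simp add: sk_def phi1_word_def phi2_word_def)
  also have "phi1_word ?n ?k (Ew ds) = blocks_word (?n + ?k) 0 [ds]"
    using phi1_word_S[of "[1..<?n]" ?n ?k] by (simp add: Ew_eq phi1_word_append phi1_word_Ymon_word)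
  also have "phi2_word ?n ?k (blocks_word ?k 0 u) = blocks_word (?n + ?k) ?n u" by (simp add: phi2_word_blocks_word)
  finally show ?case by (simp add: qp_mult qexp_def)
qed

lemma valid_Ypow: "1 \<le> i \<Longrightarrow> i \<le> N \<Longrightarrow> valid_word N (Ypow N i d)"
  by (auto simp: Ypow_def Yw_def Yiw_def valid_word_def valid_lett_def)

lemma valid_Ymon_word: "m + length ds \<le> N \<Longrightarrow> valid_word N (Ymon_word N m ds)"
proof (induction ds arbitrary: m)
  case (Cons d ds)
  then show ?case using valid_Ypow[of "m + 1" N d] by (simp add: valid_word_append)
qed (simp add: valid_word_def)

lemma valid_blocks_word: "m + length (concat u) \<le> N \<Longrightarrow> valid_word N (blocks_word N m u)"
proof (induction u arbitrary: m)
  case (Cons ds u)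
  have "valid_word N (map S [m + 1..<m + length ds])"
    using Cons.prems by (auto simp: valid_word_def valid_lett_def)
  then show ?case using Cons valid_Ymon_word[of m ds N] by (simp add: valid_word_append)
qed (simp add: valid_word_def)

text \<open>Makes the abstract results available in the concrete ring; later proofs interpret it at
  the number of strands at hand.\<close>

locale positive_rank =
  fixes N :: nat
  assumes N_pos: "1 \<le> N"

sublocale positive_rank \<subseteq> affine_hecke_algebra N "\<lambda>i. hword N [S i]" "\<lambda>i. hword N [Si i]"
  "hword N [W]" "hword N [Wi]" "scalar q_minus_qinv" "{x. trace_null N x}" scalar q_minus_qinv
  by (rule affine_hecke_algebra_ah_family[OF N_pos])

context positive_rank begin

lemma hword_replicate: "hword N (concat (replicate j w)) = hword N w ^ j"
  by (induction j) (simp_all add: hword_Nil hword_append)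

lemma hword_Ypow: "hword N (Ypow N i d) = Yp i d"
proof -
  have "hword N (Yw N i) = Y i" "hword N (Yiw N i) = Yi i"
    by (simp_all only: Yw_def Yiw_def Y_def Yi_def Tidn_def Tdn_def Tup_def Tiup_def hword_append hword_map mult.assoc)
  then show ?thesis by (simp add: Ypow_def Yp_def hword_replicate)
qed

lemma hword_Ymon_word: "hword N (Ymon_word N m ds) = Ymon m ds"
  by (induction ds arbitrary: m) (simp_all add: hword_Nil hword_append hword_Ypow)

text \<open>The \<open>T\<close> of a block commute with the lattice elements of all later strands,
  so the latter can be collected in front.\<close>

lemma hword_blocks_word: "m + length (concat u) \<le> N \<Longrightarrow> hword N (blocks_word N m u) = Ymon m (concat u) * Tblocks m u"
proof (induction u arbitrary: m)
  case Nil
  then show ?case by (simp add: hword_Nil)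
next
  case (Cons ds u)
  have c: "Tup (m + 1) (m + length ds) * Ymon (m + length ds) (concat u)
      = Ymon (m + length ds) (concat u) * Tup (m + 1) (m + length ds)"
  proof (rule Ymon_commute)
    fix i assume "m + length ds < i" "i \<le> m + length ds + length (concat u)"
    then show "Tup (m + 1) (m + length ds) * Y i = Y i * Tup (m + 1) (m + length ds)"
      unfolding Tup_def using Cons.prems
      by (intro commute_prod_list[symmetric] T_Y[symmetric]) auto
  qed (use Cons.prems in simp)
  have "hword N (blocks_word N m (ds # u)) = Ymon m ds * (Tup (m + 1) (m + length ds) * Ymon (m + length ds) (concat u)) * Tblocks (m + length ds) u"
    using Cons by (simp add: hword_append hword_Ymon_word hword_map Tup_def mult.assoc)
  then show ?case by (simp only: c) (simp add: Ymon_append mult.assoc)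
qed

lemma realizes_Estd:
  assumes "length (concat u) = N"
  shows "realizes N (scalar (qp (qexp u)) * Estd u) (PsiW u)"
proof -
  have "realizes N (hword N (blocks_word N 0 u)) (Poly_Mapping.single (N, blocks_word N 0 u) 1)"
    using assms by (intro realizes_hword valid_blocks_word) simp
  from realizes_scalar[OF this, of "qp (qexp u)"] show ?thesis
    using assms hword_blocks_word[of 0 u] by (simp add: Estd_def PsiW_eq smul_single)
qed

end

section \<open>The homomorphism\<close>

lemma conv_single_left: "conv f (Poly_Mapping.single x 1) r = lext (\<lambda>u. Poly_Mapping.single (f x u) 1) r"
  by (simp add: conv_def lext_def smul_single)

lemma conv_single_right: "conv f p (Poly_Mapping.single y 1) = lext (\<lambda>u. Poly_Mapping.single (f u y) 1) p"
  by (simp add: conv_def lext_def smul_single)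

lemma Psi_eq: "Psi = lext PsiW"
  by (intro ext) (simp add: Psi_def lext_def)

lemma Psi_conv:
  "Psi (conv (@) (conv (@) (Poly_Mapping.single x 1) r) (Poly_Mapping.single y 1))
     = lext (\<lambda>u. PsiW (x @ u @ y)) r"
  by (simp add: conv_single_left conv_single_right Psi_eq lext_lext lext_single smul_1)

lemma qexp_append: "qexp (u @ v) = qexp u + qexp v"
  by (simp add: qexp_def)

lemma qexp_Cons: "qexp (ds # u) = 1 - int (length ds) + qexp u"
  by (simp add: qexp_def)

text \<open>The words \<open>x\<close> and \<open>y\<close> around the relation become the spectator
  blocks of \<open>Estd_relation1\<close>, so two-sided multiples are treated together with the
  relation itself.\<close>

lemma relsA1_Ktr:
  assumes "r \<in> relsA1" shows "lext (\<lambda>u. PsiW (x @ u @ y)) r \<in> Ktr"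
proof -
  obtain d i where r: "r = lin [(1, [d]), (- (q1 * q2), [d[i - 1 := d ! (i - 1) - 1, i := d ! i + 1]]),
      (- (1 - q1), [take i d, drop i d])]" and i: "1 \<le> i" "i < length d"
    using assms unfolding relsA1_def by blast
  obtain a s t b where d: "d = a @ [s, t] @ b" and a: "i = Suc (length a)"
  proof -
    have "d = take (i - 1) d @ [d ! (i - 1), d ! i] @ drop (i + 1) d"
      using i Cons_nth_drop_Suc[of "i - 1" d] Cons_nth_drop_Suc[of i d] by simp
    then show thesis using i by (intro that[of "take (i - 1) d"]) auto
  qed
  have d': "d[i - 1 := d ! (i - 1) - 1, i := d ! i + 1] = a @ [s - 1, t + 1] @ b"
    "take i d = a @ [s]" "drop i d = [t] @ b"
    by (simp_all add: d a list_update_append nth_append)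
  define N where "N = length (concat (x @ [d] @ y))"
  interpret positive_rank N by unfold_locales (simp add: N_def d)
  define e where "e = qexp (x @ [d] @ y)"
  let ?u1 = "x @ [a @ [s, t] @ b] @ y" and ?u2 = "x @ [a @ [s - 1, t + 1] @ b] @ y"
    and ?u3 = "x @ [a @ [s], [t] @ b] @ y"
  have e: "qexp ?u1 = e" "qexp ?u2 = e" "qexp ?u3 = e + 1"
    by (simp_all add: e_def d qexp_append qexp_Cons)
  have len: "length (concat ?u1) = N" "length (concat ?u2) = N" "length (concat ?u3) = N"
    by (simp_all add: N_def d)
  note R = realizes_Estd[OF len(1)] realizes_Estd[OF len(2)] realizes_Estd[OF len(3)]
  have lext: "lext (\<lambda>u. PsiW (x @ u @ y)) r = smul 1 (PsiW ?u1) + smul (- (q1 * q2)) (PsiW ?u2)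
      + smul (- (1 - q1)) (PsiW ?u3)"
    unfolding r d' by (simp add: lin_Nil lin_Cons lext_add lext_zero lext_single d add.assoc)
  have real: "realizes N (scalar 1 * (scalar (qp e) * Estd ?u1) + scalar (- (q1 * q2)) * (scalar (qp e) * Estd ?u2)
      + scalar (- (1 - q1)) * (scalar (qp (e + 1)) * Estd ?u3)) (lext (\<lambda>u. PsiW (x @ u @ y)) r)"
    using R unfolding e lext by (intro realizes_add realizes_scalar)
  have eq: "scalar 1 * (scalar (qp e) * Estd ?u1) + scalar (- (q1 * q2)) * (scalar (qp e) * Estd ?u2)
      + scalar (- (1 - q1)) * (scalar (qp (e + 1)) * Estd ?u3)
     = scalar (qp e) * (Estd ?u1 - Estd ?u2 - scalar q_minus_qinv * Estd ?u3)"
  proof -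
    \<comment> \<open>The split word has one block more and hence an extra factor q, and (1 - q^-2)
      q = q - 1/q.\<close>
    have "q1 * q2 = 1" by (simp add: q1_def q2_def qp_mult qp_0)
    moreover have "(1 - q1) * qp (e + 1) = qp e * q_minus_qinv"
      by (simp add: q1_def q_minus_qinv_def left_diff_distrib right_diff_distrib qp_mult)
    then have "scalar (1 - q1) * scalar (qp (e + 1)) = scalar (qp e) * scalar q_minus_qinv" by (simp only: scalar_mult[symmetric])
    ultimately show ?thesis
      by (simp add: sc_uminus scalar_1 right_diff_distrib mult.assoc[symmetric] del: minus_diff_eq)
  qed
  have "trace_null N (scalar (qp e) * (Estd ?u1 - Estd ?u2 - scalar q_minus_qinv * Estd ?u3))"
    using Estd_relation1[OF len(1)] by (intro trace_null_scalar) simp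
  then show ?thesis using realizes_trace_null[OF real] unfolding eq by blast
qed

lemma lin_upto: "lin (map (\<lambda>a. (c, g a)) [1..m]) = (\<Sum>a=1..m. Poly_Mapping.single (g a) c)"
  by (simp add: lin_def comp_def interv_sum_list_conv_sum_set_int)

lemma cterm_eq: "cterm k d i = exchange_sum (\<lambda>s t. Poly_Mapping.single [take i d @ [s, t] @ drop (i + 1) d] 1) k (d ! i)"
  unfolding cterm_def exchange_sum_def lin_upto by (simp add: single_uminus sum_negf)

lemma relsA2_Ktr:
  assumes "r \<in> relsA2" shows "lext (\<lambda>u. PsiW (x @ u @ y)) r \<in> Ktr"
proof -
  obtain d k where r: "r = lin [(1, [[k], d]), (- 1, [d, [k]])] - smul (q2 - 1) (\<Sum>i<length d. cterm k d i)"
    and d: "d \<noteq> []"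
    using assms unfolding relsA2_def by blast
  define N where "N = length (concat (x @ [[k], d] @ y))"
  interpret positive_rank N by unfold_locales (simp add: N_def)
  define e where "e = qexp (x @ [[k], d] @ y)"
  define u where "u i s t = x @ [take i d @ [s, t] @ drop (i + 1) d] @ y" for i s t
  let ?u1 = "x @ [[k], d] @ y" and ?u2 = "x @ [d, [k]] @ y"
  have e: "qexp ?u1 = e" "qexp ?u2 = e" by (simp_all add: e_def qexp_append qexp_Cons)
  have len: "length (concat ?u1) = N" "length (concat ?u2) = N" by (simp_all add: N_def)
  have u: "qexp (u i s t) = e - 1" "length (concat (u i s t)) = N" if "i < length d" for i s t
    using that by (simp_all add: u_def e_def N_def qexp_append qexp_Cons)
  have Ru: "realizes N (scalar (qp (e - 1)) * Estd (u i s t)) (PsiW (u i s t))" if "i < length d" for i s t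
    using realizes_Estd[OF u(2)[OF that, of s t]] by (simp add: u(1)[OF that])
  have "lext (\<lambda>u. PsiW (x @ u @ y)) (cterm k d i) = exchange_sum (\<lambda>s t. PsiW (u i s t)) k (d ! i)" for i
    unfolding cterm_eq
    by (subst exchange_sum_additive) (simp_all add: lext_add lext_single smul_1 u_def)
  then have lext: "lext (\<lambda>u. PsiW (x @ u @ y)) r = smul 1 (PsiW ?u1) + smul (- 1) (PsiW ?u2)
      - smul (q2 - 1) (\<Sum>i<length d. exchange_sum (\<lambda>s t. PsiW (u i s t)) k (d ! i))"
    unfolding r by (simp add: lin_Nil lin_Cons lext_add lext_zero lext_single lext_diff lext_smul lext_sum)
  have real: "realizes N (scalar 1 * (scalar (qp e) * Estd ?u1) + scalar (- 1) * (scalar (qp e) * Estd ?u2)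
      - scalar (q2 - 1) * (\<Sum>i<length d. exchange_sum (\<lambda>s t. scalar (qp (e - 1)) * Estd (u i s t)) k (d ! i))) (lext (\<lambda>u. PsiW (x @ u @ y)) r)"
    using realizes_Estd[OF len(1)] realizes_Estd[OF len(2)] Ru unfolding e lext
    by (intro realizes_add realizes_diff realizes_scalar realizes_sum realizes_exchange_sum) auto
  have eq: "scalar 1 * (scalar (qp e) * Estd ?u1) + scalar (- 1) * (scalar (qp e) * Estd ?u2)
      - scalar (q2 - 1) * (\<Sum>i<length d. exchange_sum (\<lambda>s t. scalar (qp (e - 1)) * Estd (u i s t)) k (d ! i))
     = scalar (qp e) * (Estd ?u1 - Estd ?u2 - scalar q_minus_qinv * (\<Sum>i<length d. exchange_sum (\<lambda>s t. Estd (u i s t)) k (d ! i)))"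
  proof -
    have "(\<Sum>i<length d. exchange_sum (\<lambda>s t. scalar (qp (e - 1)) * Estd (u i s t)) k (d ! i))
        = scalar (qp (e - 1)) * (\<Sum>i<length d. exchange_sum (\<lambda>s t. Estd (u i s t)) k (d ! i))"
      unfolding sum_distrib_left
      by (intro sum.cong refl exchange_sum_additive[symmetric]) (simp add: distrib_left)
    \<comment> \<open>The merged words have one block fewer and hence an extra factor 1/q, and (q^2
      - 1)/q = q - 1/q.\<close>
    moreover have "(q2 - 1) * qp (e - 1) = qp e * q_minus_qinv"
      by (simp add: q2_def q_minus_qinv_def left_diff_distrib right_diff_distrib qp_mult add.commute)
    then have "scalar (q2 - 1) * scalar (qp (e - 1)) = scalar (qp e) * scalar q_minus_qinv" by (simp only: scalar_mult[symmetric])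
    ultimately show ?thesis
      by (simp add: sc_uminus scalar_1 right_diff_distrib mult.assoc[symmetric])
  qed
  have "trace_null N (scalar (qp e) * (Estd ?u1 - Estd ?u2 - scalar q_minus_qinv * (\<Sum>i<length d. exchange_sum (\<lambda>s t. Estd (u i s t)) k (d ! i))))"
    using Estd_relation2[OF len(1) d] unfolding u_def by (intro trace_null_scalar) simp
  then show ?thesis using realizes_trace_null[OF real] unfolding eq by blast
qed

lemma Psi_IdealA: "p \<in> IdealA \<Longrightarrow> Psi p \<in> Ktr"
  unfolding IdealA_def
proof (induction rule: lspan_induct)
  case zero
  then show ?case by (simp add: Psi_eq lext_zero Ktr_zero)
next
  case (base c v)
  then obtain x y r where "v = conv (@) (conv (@) (Poly_Mapping.single x 1) r) (Poly_Mapping.single y 1)"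
    "r \<in> relsA1 \<union> relsA2" by blast
  then have "Psi v \<in> Ktr" using relsA1_Ktr relsA2_Ktr by (auto simp: Psi_conv)
  then show ?case by (simp add: Psi_eq lext_smul Ktr_smul)
next
  case (add x y)
  then show ?case by (simp add: Psi_eq lext_add Ktr_add)
qed

section \<open>Surjectivity onto the sum of the cocenters\<close>

lemma FreeA_add: "p \<in> FreeA \<Longrightarrow> r \<in> FreeA \<Longrightarrow> p + r \<in> FreeA"
  using Poly_Mapping.keys_add[of p r] by (auto simp: FreeA_def)

lemma FreeA_single: "[] \<notin> set u \<Longrightarrow> Poly_Mapping.single u c \<in> FreeA"
  by (auto simp: FreeA_def)

lemma FreeA_smul: "p \<in> FreeA \<Longrightarrow> smul c p \<in> FreeA"
  by (auto simp: FreeA_def in_keys_iff lookup_smul)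

lemma (in positive_rank) span_sc_Std_realizes: "z \<in> span_sc Std \<Longrightarrow> \<exists>y\<in>FreeA. realizes N z (Psi y)"
proof (induction rule: span_sc.induct)
  case span_sc_zero
  then show ?case by (intro bexI[of _ 0]) (auto simp: Psi_eq lext_zero realizes_0 FreeA_def)
next
  case (span_sc_gen g c)
  then obtain u where u: "g = Estd u" "[] \<notin> set u" "length (concat u) = N" by (auto simp: Std_def)
  \<comment> \<open>The power of q in \<open>PsiW u\<close> is a unit; the second factor cancels
    it.\<close>
  let ?c = "c * qp (- qexp u)"
  have "realizes N (scalar ?c * (scalar (qp (qexp u)) * Estd u)) (smul ?c (PsiW u))"
    by (intro realizes_scalar realizes_Estd u)
  moreover have "scalar ?c * (scalar (qp (qexp u)) * Estd u) = scalar c * g"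
    by (simp add: u mult.assoc[symmetric] scalar_mult[symmetric]) (simp add: mult.assoc qp_mult qp_0)
  moreover have "smul ?c (PsiW u) = Psi (Poly_Mapping.single u ?c)"
    by (simp add: Psi_eq lext_single)
  ultimately show ?case using FreeA_single[OF u(2)] by metis
next
  case (span_sc_add x y)
  then obtain a b where "a \<in> FreeA" "b \<in> FreeA" "realizes N x (Psi a)" "realizes N y (Psi b)" by blast
  then have "realizes N (x + y) (Psi (a + b))" by (simp add: Psi_eq lext_add realizes_add)
  then show ?case using FreeA_add \<open>a \<in> FreeA\<close> \<open>b \<in> FreeA\<close> by blast
qed

lemma single_word_Psi:
  assumes "valid_word n w"
  shows "\<exists>y\<in>FreeA. Poly_Mapping.single (n, w) 1 - Psi y \<in> Ktr"
proof (cases "n = 0")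
  case True
  \<comment> \<open>In rank 0 there are no letters, so the only word is empty and is the image of
    the unit.\<close>
  have "valid_lett 0 l = False" for l by (cases l) (simp_all add: valid_lett_def)
  then have "w = []" using assms True by (cases w) (auto simp: valid_word_def)
  then have "Poly_Mapping.single (n, w) 1 - Psi (Poly_Mapping.single [] 1) = 0"
    by (simp add: True Psi_eq lext_single smul_1 PsiW_def)
  then show ?thesis using FreeA_single[of "[]" 1] Ktr_zero by force
next
  case False
  interpret positive_rank n by unfold_locales (use False in simp)
  have "hword n [l] \<in> letters" if "l \<in> set w" for l
  proof -
    have "valid_lett n l" using that assms by (simp add: valid_word_def)
    then show ?thesis unfolding letters_def by (cases l) (auto simp: valid_lett_def)
  qed
  then have "hword n w \<in> Good"
    unfolding hword_letters[of n w] by (intro word_Good) auto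
  then obtain z where z: "z \<in> span_sc Std" "trace_null n (hword n w - z)" by (auto simp: Good_def)
  obtain y where "y \<in> FreeA" "realizes n z (Psi y)" using span_sc_Std_realizes[OF z(1)] by blast
  moreover from this have "realizes n (hword n w - z) (Poly_Mapping.single (n, w) 1 - Psi y)"
    using assms by (intro realizes_diff realizes_hword)
  ultimately show ?thesis using z(2) realizes_trace_null by blast
qed

lemma Psi_surj:
  assumes "x \<in> Tgt" shows "\<exists>y\<in>FreeA. x - Psi y \<in> Ktr"
proof -
  define G where "G = {x. \<exists>y\<in>FreeA. x - Psi y \<in> Ktr}"
  have add: "a + b \<in> G" if ab: "a \<in> G" "b \<in> G" for a b
  proof -
    obtain y z where yz: "y \<in> FreeA" "z \<in> FreeA" "a - Psi y \<in> Ktr" "b - Psi z \<in> Ktr" using ab by (auto simp: G_def)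
    have "a + b - Psi (y + z) \<in> Ktr"
      using Ktr_add[OF yz(3,4)] by (simp add: Psi_eq lext_add algebra_simps)
    then show ?thesis using FreeA_add yz by (auto simp: G_def)
  qed
  have zero: "0 \<in> G"
    unfolding G_def using Ktr_zero by (auto simp: FreeA_def Psi_eq lext_zero intro!: exI[of _ 0])
  have single: "Poly_Mapping.single b (Poly_Mapping.lookup x b) \<in> G" if b: "b \<in> Poly_Mapping.keys x" for b
  proof -
    obtain n w where nw: "b = (n, w)" by (cases b)
    then have "valid_word n w" using assms b by (auto simp: Tgt_def)
    then obtain y where y: "y \<in> FreeA" "Poly_Mapping.single (n, w) 1 - Psi y \<in> Ktr" using single_word_Psi by blast
    let ?c = "Poly_Mapping.lookup x b"
    have "Poly_Mapping.single b ?c - Psi (smul ?c y) \<in> Ktr"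
      using Ktr_smul[OF y(2), of ?c] by (simp add: smul_diff smul_single Psi_eq lext_smul nw)
    then show ?thesis using FreeA_smul[OF y(1)] by (auto simp: G_def)
  qed
  have "sum f A \<in> G" if "\<And>b. b \<in> A \<Longrightarrow> f b \<in> G" for f and A :: "(nat \<times> lett list) set"
    using that by (induction A rule: infinite_finite_induct) (auto intro: add zero)
  from this[of "Poly_Mapping.keys x", OF single] have "smul 1 x \<in> G" by (simp add: smul_def)
  then show ?thesis by (simp add: smul_1 G_def)
qed

theorem theorem5:
  shows "Psi ` IdealA \<subseteq> Ktr \<and> (\<forall>x\<in>Tgt. \<exists>y\<in>FreeA. x - Psi y \<in> Ktr)"
  using Psi_IdealA Psi_surj by blast

end
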